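(* Let $\alpha,\beta$ be reals with $1/\sqrt{2}\leqslant\alpha<3/4$ and $\mathscr{B}(\alpha)\leqslant\beta\leqslant\alpha^2$, where $\mathscr{B}(\alpha)=(\sqrt{1+4\alpha}-1)/2$. Let $\mathcal{T}$ be a $\mathrm{GCB}_{\alpha,\beta}$-tree (a binary search tree all of whose nodes are $(\alpha,\beta)$-balanced). The tree obtained by using the top-down update algorithm to insert a leaf into $\mathcal{T}$ or delete a node from $\mathcal{T}$ is also a $\mathrm{GCB}_{\alpha,\beta}$-tree.
   Context: Weights: the weight $|\mathcal{T}|$ of a binary search tree is its number of empty sub-trees (number of nodes plus one); the weight $|n|$ of a node is the weight of its sub-tree. Each empty tree (weight 1) is viewed as an infinite complete binary tree whose depth-$d$ nodes have weight $2^{-d}$. For a node $n$, its left/right children are $n_1,n_2$, the children of $n_i$ are $n_{i1},n_{i2}$, and so on. $\mathsf{bal_C}(n)=\max\{|n_1|,|n_2|\}/|n|$, $\mathsf{bal_{GC}}(n)=\max_{i,j}|n_{ij}|/|n|$; $n$ is $(x,y)$-balanced if $\mathsf{bal_C}(n)\leqslant x$ and $\mathsf{bal_{GC}}(n)\leqslant y$. Let $\mathsf{R}(t)=\min\{-t,t-1\}$. Rotations on a tree with root $n$: the simple rotation makes $n_1$ the root, with children $n_{11}$ and $n$, where $n$ now has children $n_{12}$ and $n_2$; the double rotation makes $n_{12}$ the root, with left child $n_1$ (children $n_{11},n_{121}$) and right child $n$ (children $n_{122},n_2$). Mirror images exchange left and right. $\mathsf{C}(u,v,w,x)$-balancing,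 on a tree with root $n$: if $|n_1|>u|n|+w$ and $|n_{11}|\geqslant(1-v)|n|-x$, simple rotation; if $|n_2|>u|n|+w$ and $|n_{22}|\geqslant(1-v)|n|-x$, its mirror; if $|n_1|>u|n|+w$ and $|n_{11}|<(1-v)|n|-x$, double rotation; if $|n_2|>u|n|+w$ and $|n_{22}|<(1-v)|n|-x$, its mirror; otherwise do nothing. $\mathsf{GC}(y,z)$-balancing: if $|n_{11}|>y|n|+z$, simple rotation; if $|n_{22}|>y|n|+z$, its mirror; if $|n_{12}|>y|n|+z$, double rotation; if $|n_{21}|>y|n|+z$, its mirror; otherwise do nothing. $\mathsf{C}\mathsf{GC}(u,v,y,\hat{y})$-balancing, on input $\mathcal{T}$: apply $\mathsf{C}(u,v,0,0)$-balancing, obtaining $\mathcal{T}^{(1)}$; if $\mathcal{T}\neq\mathcal{T}^{(1)}$, apply $\mathsf{GC}(\hat{y},0)$-balancing to the left and right sub-trees of $\mathcal{T}^{(1)}$, then $\mathsf{GC}(\hat{y},0)$-balancing to the resulting whole tree; otherwise apply $\mathsf{GC}(y,0)$-balancing to $\mathcal{T}$. $\mathsf{R}\mathsf{C}\mathsf{GC}(u,v,y,\hat{y})$-balancing, on input $\mathcal{T}$: apply $\mathsf{C}(u,v,\mathsf{R}(u),\mathsf{R}(v))$-balancing, obtaining $\mathcal{T}^{(1)}$; if $\mathcal{T}\neq\mathcal{T}^{(1)}$: apply $\mathsf{C}\mathsf{GC}(v,v,\hat{y},\hat{y})$-balancing to both sub-trees of $\mathcal{T}^{(1)}$, then $\mathsf{GC}(\hat{y},\mathsf{R}(\hat{y}))$-balancing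 to the whole tree, then $\mathsf{C}\mathsf{GC}(v,v,\hat{y},\hat{y})$-balancing to both sub-trees of the result; otherwise apply $\mathsf{GC}(y,\mathsf{R}(y))$-balancing to $\mathcal{T}$ and, if this changed the tree, apply $\mathsf{C}\mathsf{GC}(v,v,\hat{y},\hat{y})$-balancing to both sub-trees of the result. Updates: inserting a key replaces an empty sub-tree by a new leaf $s$; deleting a key is reduced to deleting a leaf $s$ (if the node holding the key is not a leaf, one deletes instead a suitable leaf descendant of it, namely its only child or its in-order successor, and copies that leaf's key into it). An update is redundant if the key to insert is already present or the key to delete is absent; weights are then ultimately left unchanged. The top-down update algorithm, with $\hat{\alpha}=\dfrac{1-2\alpha+6\alpha^2-\sqrt{(1-\alpha)(5-\alpha)}}{5(2\alpha-1)}$ and $\hat{\beta}=\dfrac{1+\alpha-\sqrt{(1-\alpha)^2+4\alpha(\alpha^2-\beta)}}{2(1-\alpha^2+\beta)}\alpha$, operates on a tree $\mathcal{T}$ as follows: if $\mathcal{T}$ has at most $29$ nodes, insert or delete $s$ (if possible) and restructure the resulting tree into a perfectly balanced tree (one in which the weights of any two siblings differ by at most $1$); otherwise (1) apply the $\mathsf{R}\mathsf{C}\mathsf{GC}(\alpha,\hat{\alpha},\beta,\hat{\beta})$-balancing algorithm to $\mathcal{T}$, (2) update the weight of the root of $\mathcal{T}$, and (3) recursively apply the algorithm to the left or right sub-tree that contains $s$. *)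

theory Defs
  imports Complex_Main "HOL-Library.Tree"
begin

section \<open>Weights and balanced nodes\<close>

datatype dir = L | R

text \<open>\<open>wt t p\<close> is the weight of the node reached from the root of \<open>t\<close> along the path \<open>p\<close>.
  An empty tree counts as an infinite complete binary tree whose nodes at depth \<open>d\<close> have
  weight \<open>2\<^sup>-\<^sup>d\<close>, so \<open>wt\<close> is defined for all paths.\<close>

fun wt :: "'a tree \<Rightarrow> dir list \<Rightarrow> real" where
  "wt \<langle>\<rangle> p = (1/2) ^ length p"
| "wt \<langle>l, a, r\<rangle> [] = real (size1 \<langle>l, a, r\<rangle>)"
| "wt \<langle>l, a, r\<rangle> (L # p) = wt l p"
| "wt \<langle>l, a, r\<rangle> (R # p) = wt r p"

definition bal_C :: "'a tree \<Rightarrow> real" where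
  "bal_C t = max (wt t [L]) (wt t [R]) / wt t []"

definition bal_GC :: "'a tree \<Rightarrow> real" where
  "bal_GC t = Max {wt t [L, L], wt t [L, R], wt t [R, L], wt t [R, R]} / wt t []"

definition node_balanced :: "real \<Rightarrow> real \<Rightarrow> 'a tree \<Rightarrow> bool" where
  "node_balanced x y t \<longleftrightarrow> bal_C t \<le> x \<and> bal_GC t \<le> y"

definition GCB :: "real \<Rightarrow> real \<Rightarrow> 'a::linorder tree \<Rightarrow> bool" where
  "GCB \<alpha> \<beta> t \<longleftrightarrow> bst t \<and> (\<forall>n \<in> subtrees t. n \<noteq> \<langle>\<rangle> \<longrightarrow> node_balanced \<alpha> \<beta> n)"


section \<open>Rotations\<close>

text \<open>A rotation leaves a tree of unsuitable shape unchanged.\<close>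

fun rot :: "'a tree \<Rightarrow> 'a tree" where
  "rot \<langle>\<langle>t11, b, t12\<rangle>, a, t2\<rangle> = \<langle>t11, b, \<langle>t12, a, t2\<rangle>\<rangle>"
| "rot t = t"

fun rot_mirror :: "'a tree \<Rightarrow> 'a tree" where
  "rot_mirror \<langle>t1, a, \<langle>t21, b, t22\<rangle>\<rangle> = \<langle>\<langle>t1, a, t21\<rangle>, b, t22\<rangle>"
| "rot_mirror t = t"

fun drot :: "'a tree \<Rightarrow> 'a tree" where
  "drot \<langle>\<langle>t11, b, \<langle>t121, c, t122\<rangle>\<rangle>, a, t2\<rangle> = \<langle>\<langle>t11, b, t121\<rangle>, c, \<langle>t122, a, t2\<rangle>\<rangle>"
| "drot t = t"

fun drot_mirror :: "'a tree \<Rightarrow> 'a tree" where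
  "drot_mirror \<langle>t1, a, \<langle>\<langle>t211, c, t212\<rangle>, b, t22\<rangle>\<rangle> = \<langle>\<langle>t1, a, t211\<rangle>, c, \<langle>t212, b, t22\<rangle>\<rangle>"
| "drot_mirror t = t"


section \<open>Balancing algorithms\<close>

text \<open>If several rotations are triggered, the first one listed is performed.\<close>

definition C_balance :: "real \<Rightarrow> real \<Rightarrow> real \<Rightarrow> real \<Rightarrow> 'a tree \<Rightarrow> 'a tree" where
  "C_balance u v w x t =
    (if wt t [L] > u * wt t [] + w \<and> wt t [L, L] \<ge> (1 - v) * wt t [] - x then rot t
     else if wt t [R] > u * wt t [] + w \<and> wt t [R, R] \<ge> (1 - v) * wt t [] - x then rot_mirror t
     else if wt t [L] > u * wt t [] + w \<and> wt t [L, L] < (1 - v) * wt t [] - x then drot t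
     else if wt t [R] > u * wt t [] + w \<and> wt t [R, R] < (1 - v) * wt t [] - x then drot_mirror t
     else t)"

definition GC_balance :: "real \<Rightarrow> real \<Rightarrow> 'a tree \<Rightarrow> 'a tree" where
  "GC_balance y z t =
    (if wt t [L, L] > y * wt t [] + z then rot t
     else if wt t [R, R] > y * wt t [] + z then rot_mirror t
     else if wt t [L, R] > y * wt t [] + z then drot t
     else if wt t [R, L] > y * wt t [] + z then drot_mirror t
     else t)"

fun on_children :: "('a tree \<Rightarrow> 'a tree) \<Rightarrow> 'a tree \<Rightarrow> 'a tree" where
  "on_children f \<langle>\<rangle> = \<langle>\<rangle>"
| "on_children f \<langle>l, a, r\<rangle> = \<langle>f l, a, f r\<rangle>"

definition CGC_balance :: "real \<Rightarrow> real \<Rightarrow> real \<Rightarrow> real \<Rightarrow> 'a tree \<Rightarrow> 'a tree" where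
  "CGC_balance u v y y' t =
    (let t1 = C_balance u v 0 0 t in
     if t \<noteq> t1 then GC_balance y' 0 (on_children (GC_balance y' 0) t1)
     else GC_balance y 0 t)"

definition R_shift :: "real \<Rightarrow> real" where
  "R_shift t = min (- t) (t - 1)"

definition RCGC_balance :: "real \<Rightarrow> real \<Rightarrow> real \<Rightarrow> real \<Rightarrow> 'a tree \<Rightarrow> 'a tree" where
  "RCGC_balance u v y y' t =
    (let t1 = C_balance u v (R_shift u) (R_shift v) t in
     if t \<noteq> t1 then
       on_children (CGC_balance v v y' y')
         (GC_balance y' (R_shift y') (on_children (CGC_balance v v y' y') t1))
     else
       (let t2 = GC_balance y (R_shift y) t in
        if t \<noteq> t2 then on_children (CGC_balance v v y' y') t2 else t2))"

lemma size_rot [simp]: "size (rot t) = size t"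
  by (cases t rule: rot.cases) simp_all

lemma size_rot_mirror [simp]: "size (rot_mirror t) = size t"
  by (cases t rule: rot_mirror.cases) simp_all

lemma size_drot [simp]: "size (drot t) = size t"
  by (cases t rule: drot.cases) simp_all

lemma size_drot_mirror [simp]: "size (drot_mirror t) = size t"
  by (cases t rule: drot_mirror.cases) simp_all

lemma size_on_children: "(\<And>s. size (f s) = size s) \<Longrightarrow> size (on_children f t) = size t"
  by (cases t) simp_all

lemma size_C_balance [simp]: "size (C_balance u v w x t) = size t"
  by (simp add: C_balance_def)

lemma size_GC_balance [simp]: "size (GC_balance y z t) = size t"
  by (simp add: GC_balance_def)

lemma size_CGC_balance [simp]: "size (CGC_balance u v y y' t) = size t"
  by (simp add: CGC_balance_def Let_def size_on_children)

lemma size_RCGC_balance [simp]: "size (RCGC_balance u v y y' t) = size t"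
  by (simp add: RCGC_balance_def Let_def size_on_children)

lemma size_children_RCGC_balance:
  assumes "RCGC_balance u v y y' t = \<langle>l, a, r\<rangle>"
  shows "size l < size t" "size r < size t"
  using size_RCGC_balance[of u v y y' t] unfolding assms by simp_all


section \<open>Plain updates of binary search trees\<close>

fun bst_insert :: "'a::linorder \<Rightarrow> 'a tree \<Rightarrow> 'a tree" where
  "bst_insert k \<langle>\<rangle> = \<langle>\<langle>\<rangle>, k, \<langle>\<rangle>\<rangle>"
| "bst_insert k \<langle>l, a, r\<rangle> =
    (if k < a then \<langle>bst_insert k l, a, r\<rangle>
     else if a < k then \<langle>l, a, bst_insert k r\<rangle>
     else \<langle>l, a, r\<rangle>)"

text \<open>The key in the root of \<open>\<langle>l, a, r\<rangle>\<close> has \<open>hd (inorder r)\<close> as its in-order successor if \<open>r\<close>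
  is not empty. Replacing a node by its only child is the same as deleting that child and copying
  its key when the child is a leaf.\<close>

fun bst_delete :: "'a::linorder \<Rightarrow> 'a tree \<Rightarrow> 'a tree" where
  "bst_delete k \<langle>\<rangle> = \<langle>\<rangle>"
| "bst_delete k \<langle>l, a, r\<rangle> =
    (if k < a then \<langle>bst_delete k l, a, r\<rangle>
     else if a < k then \<langle>l, a, bst_delete k r\<rangle>
     else if l = \<langle>\<rangle> then r
     else if r = \<langle>\<rangle> then l
     else (let m = hd (inorder r) in \<langle>l, m, bst_delete m r\<rangle>))"

datatype 'a update = Insert (key: 'a) | Delete (key: 'a)

fun bst_update :: "'a::linorder update \<Rightarrow> 'a tree \<Rightarrow> 'a tree" where
  "bst_update (Insert k) t = bst_insert k t"
| "bst_update (Delete k) t = bst_delete k t"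


section \<open>The top-down update algorithm\<close>

definition alpha_hat :: "real \<Rightarrow> real" where
  "alpha_hat \<alpha> =
    (1 - 2 * \<alpha> + 6 * \<alpha>^2 - sqrt ((1 - \<alpha>) * (5 - \<alpha>))) / (5 * (2 * \<alpha> - 1))"

definition beta_hat :: "real \<Rightarrow> real \<Rightarrow> real" where
  "beta_hat \<alpha> \<beta> =
    (1 + \<alpha> - sqrt ((1 - \<alpha>)^2 + 4 * \<alpha> * (\<alpha>^2 - \<beta>))) / (2 * (1 - \<alpha>^2 + \<beta>)) * \<alpha>"

definition B_min :: "real \<Rightarrow> real" where
  "B_min \<alpha> = (sqrt (1 + 4 * \<alpha>) - 1) / 2"

text \<open>The perfectly balanced tree built for a small tree is not unique, so the algorithm takes
  the restructuring procedure as a parameter. In a perfectly balanced tree (\<^const>\<open>wbalanced\<close>) the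
  sizes, and thus also the weights, of siblings differ by at most 1.\<close>

definition perfect_restructuring :: "('a tree \<Rightarrow> 'a tree) \<Rightarrow> bool" where
  "perfect_restructuring f \<longleftrightarrow> (\<forall>t. wbalanced (f t) \<and> inorder (f t) = inorder t)"

text \<open>The algorithm reads the weight of a node only before that weight is updated, so all weights
  can be computed from the current tree. If the key to insert is found in the root, there is no
  sub-tree to descend into. If the key to delete is found in the root, the leaf to delete lies
  in the right sub-tree, towards the in-order successor, whose key moves into the root: in a
  balanced tree with at least 30 nodes both children of the root are nodes.\<close>

function top_down_update ::
  "real \<Rightarrow> real \<Rightarrow> ('a tree \<Rightarrow> 'a tree) \<Rightarrow> 'a::linorder update \<Rightarrow> 'a tree \<Rightarrow> 'a tree" where
  "top_down_update \<alpha> \<beta> restructure upd t =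
    (if size t \<le> 29 then restructure (bst_update upd t)
     else
       (case RCGC_balance \<alpha> (alpha_hat \<alpha>) \<beta> (beta_hat \<alpha> \<beta>) t of
          \<langle>\<rangle> \<Rightarrow> \<langle>\<rangle>
        | \<langle>l, a, r\<rangle> \<Rightarrow>
            if key upd < a then \<langle>top_down_update \<alpha> \<beta> restructure upd l, a, r\<rangle>
            else if a < key upd then \<langle>l, a, top_down_update \<alpha> \<beta> restructure upd r\<rangle>
            else
              (case upd of
                 Insert _ \<Rightarrow> \<langle>l, a, r\<rangle>
               | Delete _ \<Rightarrow>
                   (let m = hd (inorder r)
                    in \<langle>l, m, top_down_update \<alpha> \<beta> restructure (Delete m) r\<rangle>))))"
  by pat_completeness auto

termination
  by (relation "Wellfounded.measure (\<lambda>(\<alpha>, \<beta>, f, upd, t). size t)")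
     (auto dest: size_children_RCGC_balance)

declare top_down_update.simps [simp del]

lemma ex_perfect_restructuring: "\<exists>f :: 'a tree \<Rightarrow> 'a tree. perfect_restructuring f"
proof -
  have "\<exists>t. wbalanced t \<and> inorder t = xs" for xs :: "'a list"
  proof (induction xs rule: length_induct)
    case (1 xs)
    show ?case
    proof (cases "xs = []")
      case True
      then show ?thesis by (intro exI[of _ "\<langle>\<rangle>"]) simp
    next
      case False
      let ?n = "length xs div 2"
      have n: "?n < length xs" using False by simp
      obtain l where l: "wbalanced l" "inorder l = take ?n xs"
        using 1 n by (metis length_take min.strict_coboundedI2 min.commute)
      have "length (drop (Suc ?n) xs) < length xs" using n by simp
      then obtain r where r: "wbalanced r" "inorder r = drop (Suc ?n) xs"
        using 1 by blast
      have "size l = ?n" "size r = length xs - Suc ?n"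
        using l(2) r(2) n by (simp_all flip: length_inorder)
      then have "wbalanced \<langle>l, xs ! ?n, r\<rangle>" using l r n by auto
      moreover have "inorder \<langle>l, xs ! ?n, r\<rangle> = xs"
        using l r n by (simp add: id_take_nth_drop[symmetric])
      ultimately show ?thesis by blast
    qed
  qed
  then have "\<forall>t :: 'a tree. \<exists>t'. wbalanced t' \<and> inorder t' = inorder t" by blast
  then show ?thesis unfolding perfect_restructuring_def by metis
qed

end

theory Submission
  imports Defs
begin

text \<open>Write \<open>\<alpha> = B + B\<^sup>2\<close> with \<open>B = B_min \<alpha> < 1 / 2\<close>. Rotations preserve the balance conditions for three
  reasons: a child contains at least a fraction \<open>1 - \<alpha> \<ge> B\<^sup>2\<close> of its parent; a grandchild heavier than
  \<open>B n\<close> has a sibling lighter than \<open>B\<close> times itself and an uncle lighter than \<open>B\<close> times its parent; and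
  \<open>alpha_hat \<alpha> \<ge> (1 + \<alpha>) / (1 + 2 \<alpha>)\<close>. The rotations at the root of a tree of weight \<open>n \<ge> 31\<close> use
  thresholds that are off by less than 1; they may leave children that are slightly too unbalanced,
  which \<open>CGC\<close>-balancing repairs. Afterwards the root stays balanced under any change of weight by 1
  below it. The update of a child may rearrange the grandchildren of the root, which is harmless
  because balancing never increases the weight of the heavier child of a node.\<close>

section \<open>Weights\<close>

text \<open>An induction concluding balance alone would fail: the root is rebalanced before the
  weight below it changes, and the recursive call may hand back a child whose own children are
  arranged differently. The predicate \<open>updated\<close> therefore also records the change
  \<open>d\<close> of the weight, with \<open>d = 0\<close> for redundant updates, and bounds the
  heavier child of the result by that of the input plus \<open>max 0 d\<close>. The terms
  \<open>R_shift\<close> are what the conditions at the root need in order to survive both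
  \<open>m - 1\<close> and \<open>m + 1\<close>. The estimates are of two kinds.
  \<open>GC_rot\<close> and \<open>GC_drot\<close> concern trees of any size and have little slack:
  at \<open>\<beta> = B\<close> or in the limit \<alpha> = 3/4 some of their inequalities turn into
  equalities, so they rest on identities in \<open>B\<close>. At a root of weight at least 31 there
  is room: \<alpha> lies between 0.7071 and 0.75, \<open>B\<close> above 0.478 and \<beta> below
  0.5625, and linear arithmetic with these decimals absorbs the shifts.\<close>

lemma wt_Nil: "wt t [] = real (size1 t)"
  by (cases t) auto

lemma wt_Node_Nil [simp]: "wt \<langle>l, a, r\<rangle> [] = wt l [] + wt r []"
  by (simp add: wt_Nil)

declare wt.simps(2) [simp del]

lemma wt_Nil_ge_1: "1 \<le> wt t []"
  by (simp add: wt_Nil size1_size)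

lemma wt_pos: "0 < wt t p"
  by (induction t p rule: wt.induct) (auto simp: wt_Nil size1_size)

lemma wt_split: "wt t [L] + wt t [R] = wt t []"
  by (cases t) auto

definition C_bal :: "real \<Rightarrow> 'a tree \<Rightarrow> bool" where
  "C_bal x t \<longleftrightarrow> wt t [L] \<le> x * wt t [] \<and> wt t [R] \<le> x * wt t []"

definition GC_bal :: "real \<Rightarrow> 'a tree \<Rightarrow> bool" where
  "GC_bal y t \<longleftrightarrow> wt t [L, L] \<le> y * wt t [] \<and> wt t [L, R] \<le> y * wt t [] \<and>
    wt t [R, L] \<le> y * wt t [] \<and> wt t [R, R] \<le> y * wt t []"

fun balanced :: "real \<Rightarrow> real \<Rightarrow> 'a tree \<Rightarrow> bool" where
  "balanced x y \<langle>\<rangle> \<longleftrightarrow> True"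
| "balanced x y \<langle>l, a, r\<rangle> \<longleftrightarrow>
    C_bal x \<langle>l, a, r\<rangle> \<and> GC_bal y \<langle>l, a, r\<rangle> \<and> balanced x y l \<and> balanced x y r"

text \<open>The input that GC-balancing can repair: nothing is asked of the grandchildren of the
  root. For the empty tree the second conjunct is vacuous.\<close>

definition almost :: "real \<Rightarrow> real \<Rightarrow> real \<Rightarrow> 'a tree \<Rightarrow> bool" where
  "almost x y z t \<longleftrightarrow> C_bal z t \<and> (\<forall>l a r. t = \<langle>l, a, r\<rangle> \<longrightarrow> balanced x y l \<and> balanced x y r)"

definition heavy :: "'a tree \<Rightarrow> real" where
  "heavy t = max (wt t [L]) (wt t [R])"

lemma node_balanced_iff: "node_balanced x y t \<longleftrightarrow> C_bal x t \<and> GC_bal y t"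
  using wt_pos[of t "[]"]
  by (auto simp: node_balanced_def C_bal_def GC_bal_def bal_C_def bal_GC_def pos_divide_le_eq)

lemma balanced_iff: "balanced x y t \<longleftrightarrow> (\<forall>n \<in> subtrees t. n \<noteq> \<langle>\<rangle> \<longrightarrow> node_balanced x y n)"
  by (induction t) (auto simp: node_balanced_iff)

lemma GCB_iff: "GCB x y t \<longleftrightarrow> bst t \<and> balanced x y t"
  by (simp add: GCB_def balanced_iff)

section \<open>Mirror images\<close>

fun flip :: "dir \<Rightarrow> dir" where
  "flip L = R" | "flip R = L"

lemma wt_mirror: "wt (mirror t) p = wt t (map flip p)"
proof (induction t arbitrary: p)
  case (Node l a r)
  show ?case
  proof (cases p)
    case (Cons d q)
    then show ?thesis using Node by (cases d) auto
  qed (simp add: wt_Nil)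
qed auto

lemma C_bal_mirror [simp]: "C_bal x (mirror t) = C_bal x t"
  by (auto simp: C_bal_def wt_mirror)

lemma GC_bal_mirror [simp]: "GC_bal y (mirror t) = GC_bal y t"
  by (auto simp: GC_bal_def wt_mirror)

lemma balanced_mirror [simp]: "balanced x y (mirror t) = balanced x y t"
proof (induction t)
  case (Node l a r)
  then show ?case
    using C_bal_mirror[of x "\<langle>l, a, r\<rangle>"] GC_bal_mirror[of y "\<langle>l, a, r\<rangle>"] by auto
qed auto

lemma almost_mirror [simp]: "almost x y z (mirror t) = almost x y z t"
  by (cases t) (auto simp: almost_def C_bal_mirror[of z "Node _ _ _", simplified])

lemma heavy_mirror [simp]: "heavy (mirror t) = heavy t"
  by (auto simp: heavy_def wt_mirror)

lemma rot_mirror_eq: "rot_mirror t = mirror (rot (mirror t))"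
  by (cases t rule: rot_mirror.cases) auto

lemma drot_mirror_eq: "drot_mirror t = mirror (drot (mirror t))"
  by (cases t rule: drot_mirror.cases) auto

lemma mirror_eq_Node: "mirror t = \<langle>l, a, r\<rangle> \<longleftrightarrow> t = \<langle>mirror r, a, mirror l\<rangle>"
  by (metis mirror.simps(2) mirror_mirror)

lemma heavy_Node: "heavy \<langle>l, a, r\<rangle> = max (wt l []) (wt r [])"
  by (simp add: heavy_def)

lemma not_Leaf_if_wt_gt_1: "1 < wt t [] \<Longrightarrow> \<exists>l a r. t = \<langle>l, a, r\<rangle>"
  by (cases t) auto

section \<open>Rotations for grandchildren that are too heavy\<close>

text \<open>The variables \<open>B\<close>, \<open>v\<close> and \<open>y\<close> stand for \<^const>\<open>B_min\<close>, \<^const>\<open>alpha_hat\<close> and \<^const>\<open>beta_hat\<close>. The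
  exact values of the latter two do not matter.\<close>

locale gcb_params =
  fixes \<alpha> \<beta> B v y :: real
  assumes alpha_B: "\<alpha> = B + B * B"
    and B_bounds: "0 < B" "B < 1 / 2"
    and alpha_sq: "1 \<le> 2 * (\<alpha> * \<alpha>)"
    and beta_bounds: "B \<le> \<beta>" "\<beta> \<le> \<alpha> * \<alpha>"
    and v_bounds: "1 + \<alpha> \<le> v * (1 + 2 * \<alpha>)" "v \<le> \<alpha>"
    and y_bounds: "B \<le> y" "y \<le> \<beta>" "\<alpha> \<le> y * (2 - \<beta>)"
begin

abbreviation "bal \<equiv> balanced \<alpha> \<beta>"
abbreviation "alm \<equiv> almost \<alpha> \<beta>"

section \<open>Numerical bounds on the parameters\<close>

lemma alpha_less: "\<alpha> < 3 / 4"
proof -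
  have "B * B < 1 / 2 * (1 / 2)"
    using B_bounds by (intro mult_strict_mono) auto
  then show ?thesis using alpha_B B_bounds by simp
qed

lemma alpha_greater: "7071 / 10000 < \<alpha>"
proof (rule ccontr)
  assume "\<not> ?thesis"
  then have "\<alpha> * \<alpha> \<le> 7071 / 10000 * (7071 / 10000)"
    using alpha_B B_bounds by (intro mult_mono) (auto simp: add_nonneg_nonneg)
  then show False using alpha_sq by simp
qed

text \<open>\<open>0.478 + 0.478^2 = 0.706484\<close> lies just below 0.7071.\<close>

lemma B_greater: "478 / 1000 < B"
proof (rule ccontr)
  assume *: "\<not> ?thesis"
  then have "B * B \<le> 478 / 1000 * (478 / 1000)"
    using B_bounds by (intro mult_mono) auto
  then show False using alpha_greater alpha_B * by simp
qed

lemma beta_less: "\<beta> < 9 / 16"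
proof -
  have "\<alpha> * \<alpha> < 3 / 4 * (3 / 4)"
    using alpha_less alpha_greater by (intro mult_strict_mono) auto
  then show ?thesis using beta_bounds by simp
qed

text \<open>\<open>(1 + \<alpha>) / (1 + 2 * \<alpha>)\<close> decreases in \<alpha> and equals 7/10
  at \<alpha> = 3/4.\<close>

lemma v_greater: "7 / 10 < v"
proof (rule ccontr)
  assume "\<not> ?thesis"
  then have "v * (1 + 2 * \<alpha>) \<le> 7 / 10 * (1 + 2 * \<alpha>)"
    using alpha_greater by (intro mult_right_mono) auto
  then show False using v_bounds alpha_less by simp
qed

text \<open>The difference \<open>1 - \<alpha> - B * B\<close> factors as
  \<open>(1 - 2 * B) * (1 + B)\<close>; it vanishes at \<open>B = 1 / 2\<close>, which is the limit
  \<alpha> = 3/4.\<close>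

lemma B_sq_le: "B * B \<le> 1 - \<alpha>"
proof -
  have "0 \<le> (1 - 2 * B) * (1 + B)"
    using B_bounds by simp
  then show ?thesis unfolding alpha_B by (simp add: algebra_simps)
qed

lemma alpha_minus_beta_le: "\<alpha> - \<beta> \<le> B * B"
  using alpha_B beta_bounds by simp

lemma alpha_beta_less: "\<beta> < \<alpha>"
  using beta_less alpha_greater by simp

lemmas param_bounds = alpha_less alpha_greater B_greater B_bounds beta_less v_greater beta_bounds(1)
  v_bounds(2) alpha_beta_less y_bounds(1,2)

lemma C_bal_mono: "C_bal x t \<Longrightarrow> x \<le> x' \<Longrightarrow> C_bal x' t"
  unfolding C_bal_def using mult_right_mono[of x x' "wt t []"] wt_pos[of t "[]"] by linarith

text \<open>The empty tree is included because its virtual children have weight 1/2, below \<alpha>;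
  in the next lemma its virtual grandchildren have weight 1/4, below \<beta>.\<close>

lemma bal_C_bal: "bal t \<Longrightarrow> C_bal \<alpha> t"
  using param_bounds by (cases t) (auto simp: C_bal_def)

lemma bal_GC_bal: "bal t \<Longrightarrow> GC_bal \<beta> t"
  using param_bounds by (cases t) (auto simp: GC_bal_def)

lemma bal_almost: "bal t \<Longrightarrow> \<alpha> \<le> x \<Longrightarrow> alm x t"
  unfolding almost_def using bal_C_bal C_bal_mono by fastforce

lemma n1_le_n2: "n1 \<le> \<alpha> * (n1 + n2) \<Longrightarrow> (1 - \<alpha>) * n1 \<le> \<alpha> * n2"
  by (simp add: algebra_simps)

text \<open>A grandchild heavier than \<open>B n\<close> forces its parent to be heavy, as \<open>\<alpha> = B (1 + B)\<close>.\<close>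

lemma heavy_parent:
  assumes "B * (n1 + n2) < g" "g \<le> \<alpha> * n1"
  shows "n2 < B * n1"
proof -
  have "B * n2 < B * (B * n1)"
    using assms unfolding alpha_B by (simp add: algebra_simps)
  then show ?thesis using B_bounds by simp
qed

text \<open>The child has at most \<open>\<alpha> n = B n + B * B n\<close>, of which the heavy
  grandchild uses more than \<open>B n\<close>. What remains is below \<open>B * B n\<close>, hence
  below \<open>B * g\<close>.\<close>

lemma light_sibling:
  assumes "n1 \<le> \<alpha> * (n1 + n2)" "B * (n1 + n2) < g"
  shows "n1 - g < B * g" "n1 - g < B * B * (n1 + n2)"
proof -
  show *: "n1 - g < B * B * (n1 + n2)"
    using assms unfolding alpha_B by (simp add: algebra_simps)
  have "B * (B * (n1 + n2)) < B * g"
    using assms B_bounds by simp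
  then show "n1 - g < B * g" using * by (simp add: algebra_simps)
qed

text \<open>The parts \<open>n12\<close> and \<open>n2\<close> are light compared with
  \<open>n1\<close>, yet bounded below: \<open>n12\<close> by \<open>(1 - \<alpha>) * n1\<close> and
  \<open>n2\<close> by \<open>(1 - \<alpha>) / \<alpha> * n1\<close>. Opposing these bounds balances
  the new node that joins \<open>t12\<close> and \<open>r\<close>.\<close>

lemma GC_rot:
  assumes "alm \<alpha> t" "y * wt t [] < wt t [L, L]"
  shows "bal (rot t) \<and> heavy (rot t) \<le> heavy t"
proof -
  \<comment> \<open>The empty tree has virtual grandchildren of weight 1/4, less than
    \<open>y\<close>.\<close>
  obtain l a r where t: "t = \<langle>l, a, r\<rangle>"
    using assms param_bounds by (cases t) (auto simp: power2_eq_square)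
  have yn: "B * wt t [] < wt t [L, L]"
    using assms(2) param_bounds mult_right_mono[of B y "wt t []"] wt_pos[of t "[]"] by linarith
  \<comment> \<open>An empty left child would have virtual children of weight exactly 1/2.\<close>
  have "1 / 2 < B * wt t []"
  proof -
    have "2 \<le> wt t []" using wt_Nil_ge_1[of l] wt_Nil_ge_1[of r] by (simp add: t)
    then have "478 / 1000 * 2 < B * wt t []"
      using param_bounds by (intro mult_less_le_imp_less) auto
    then show ?thesis by simp
  qed
  then obtain t11 b t12 where l: "l = \<langle>t11, b, t12\<rangle>"
    using yn by (cases l) (auto simp: t)
  define n11 n12 n2 where n: "n11 = wt t11 []" "n12 = wt t12 []" "n2 = wt r []"
  define n1 where "n1 = n11 + n12"
  note n = n n1_def
  have pos: "0 < n11" "0 < n12" "0 < n2" "0 < n1"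
    unfolding n by (auto intro: wt_pos add_pos_pos)
  have b: "bal t11" "bal t12" "bal r" "bal l" "C_bal \<alpha> t"
    using assms(1) by (auto simp: almost_def t l)
  have n1: "n1 \<le> \<alpha> * (n1 + n2)" and n2: "n2 \<le> \<alpha> * (n1 + n2)"
    using b(5) by (auto simp: C_bal_def t l n)
  have c: "n11 \<le> \<alpha> * n1" "n12 \<le> \<alpha> * n1"
    using bal_C_bal[OF b(4)] by (auto simp: C_bal_def l n)
  have c': "(1 - \<alpha>) * n1 \<le> n12"
    using c by (simp add: n algebra_simps)
  have g: "wt t11 [L] \<le> \<beta> * n1" "wt t11 [R] \<le> \<beta> * n1"
    using bal_GC_bal[OF b(4)] by (auto simp: GC_bal_def l n)
  have d: "wt t12 [L] \<le> \<alpha> * n12" "wt t12 [R] \<le> \<alpha> * n12"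
    "wt r [L] \<le> \<alpha> * n2" "wt r [R] \<le> \<alpha> * n2"
    using bal_C_bal[OF b(2)] bal_C_bal[OF b(3)] by (auto simp: C_bal_def n)
  have h: "B * (n1 + n2) < n11"
    using yn by (simp add: t l n)
  note h1 = n1_le_n2[OF n1] 
  have h2: "n2 < B * n1" using heavy_parent[OF h] c by simp
  have h3: "n12 < B * n11" "n12 < B * B * (n1 + n2)"
    using light_sibling[OF n1 h] by (auto simp: n)
  have Bn1: "B * n1 \<le> \<beta> * n1" "\<beta> * n1 \<le> \<beta> * (n1 + n2)" "\<alpha> * n2 \<le> n2" "B * n11 \<le> B * n1"
    "B * n1 \<le> \<alpha> * n1" "\<beta> * n2 \<ge> \<alpha> * \<beta> * n2"
    using param_bounds pos by (auto intro!: mult_right_mono simp: n)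
  have Bn: "478 / 1000 * (n1 + n2) \<le> B * (n1 + n2)" "7/10 * (n1 + n2) \<le> \<alpha> * (n1 + n2)"
    by (rule mult_right_mono; use param_bounds pos in simp)+
  have r1: "n12 + n2 \<le> 7 / 10 * (n1 + n2)"
  proof -
    have "478 / 1000 * (n1 + n2) < n11" using less_le_trans h Bn(1) by simp
    then show ?thesis using pos by (simp add: n1_def)
  qed
  have "C_bal \<alpha> (rot t)"
  proof -
    have "n12 + n2 \<le> \<alpha> * (n1 + n2)" "n11 \<le> \<alpha> * (n1 + n2)"
      using r1 Bn pos n1 by (linarith, simp add: n1_def)
    then show ?thesis by (simp add: C_bal_def t l n n1_def add.assoc)
  qed
  moreover have "GC_bal \<beta> (rot t)"
  proof -
    have "wt t11 [L] \<le> \<beta> * (n1 + n2)" "wt t11 [R] \<le> \<beta> * (n1 + n2)" "n12 \<le> \<beta> * (n1 + n2)"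
      "n2 \<le> \<beta> * (n1 + n2)"
      using g Bn1 h3 h2 by linarith+
    then show ?thesis by (simp add: GC_bal_def t l n n1_def add.assoc)
  qed
  moreover have "C_bal \<alpha> \<langle>t12, a, r\<rangle>"
  proof -
    have "(1 - \<alpha>) * n12 \<le> (1 - \<alpha>) * n1" "(1 - \<alpha>) * n2 \<le> (1 - \<alpha>) * (\<alpha> * n1)"
      "\<alpha> * ((1 - \<alpha>) * n1) \<le> \<alpha> * n12"
      using param_bounds pos order.trans[OF less_imp_le[OF h2] Bn1(5)] c' by (auto intro!: mult_left_mono simp: n)
    then show ?thesis using h1 by (simp add: C_bal_def flip: n) (simp add: algebra_simps)
  qed
  moreover have "GC_bal \<beta> \<langle>t12, a, r\<rangle>"
  proof -
    \<comment> \<open>The grandchildren of the new node are at most \<open>\<alpha> * n12\<close>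
      and \<open>\<alpha> * n2\<close>, so it suffices to bound these two by
      \<open>\<beta> * (n12 + n2)\<close>.\<close>
    have "(\<alpha> - \<beta>) * n12 \<le> (1 - \<alpha>) * (\<beta> * n1)"
    proof -
      have "n12 \<le> \<beta> * n1" using h3 Bn1 by linarith
      then show ?thesis using alpha_minus_beta_le B_sq_le pos param_bounds by (intro mult_mono) auto
    qed
    moreover have "\<beta> * ((1 - \<alpha>) * n1) \<le> \<beta> * (\<alpha> * n2)"
      using param_bounds h1 by (intro mult_left_mono) auto
    ultimately have 1: "\<alpha> * n12 \<le> \<beta> * (n12 + n2)"
      using Bn1 by (simp add: algebra_simps)
    have "(\<alpha> - \<beta>) * n2 \<le> B * B * (B * n1)"
      using alpha_minus_beta_le h2 pos param_bounds by (intro mult_mono) auto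
    moreover have "B * (B * B * n1) \<le> \<beta> * ((1 - \<alpha>) * n1)"
      using B_sq_le param_bounds pos by (intro mult_mono) auto
    moreover have "\<beta> * ((1 - \<alpha>) * n1) \<le> \<beta> * n12"
      using c' param_bounds by (intro mult_left_mono) auto
    ultimately have 2: "\<alpha> * n2 \<le> \<beta> * (n12 + n2)"
      by (simp add: algebra_simps)
    show ?thesis using 1 2 d by (simp add: GC_bal_def flip: n)
  qed
  moreover have "heavy (rot t) \<le> heavy t"
  proof -
    \<comment> \<open>Only \<open>n2 \<le> n11\<close> is at stake: \<open>n2\<close> is at most a
      third of the whole weight, \<open>n11\<close> more than 0.478 of it.\<close>
    have "B * n1 \<le> 1 / 2 * n1" using param_bounds pos by (intro mult_right_mono) auto
    then have "2 * n2 \<le> n11 + n12" using h2 n1_def by linarith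
    moreover have "478 * (n11 + n12 + n2) \<le> 1000 * n11"
      using le_less_trans[OF Bn(1) h] by (simp add: n1_def)
    ultimately have "n12 + n2 \<le> n1" "n11 \<le> n1"
      using pos unfolding n1_def by (simp_all add: algebra_simps)
    then show ?thesis by (simp add: t l heavy_Node n)
  qed
  ultimately show ?thesis
    using b by (simp add: t l)
qed

text \<open>Expanded in \<open>d = \<beta> - B\<close>, the difference of the two sides has no
  constant term and non-negative coefficients; at \<open>\<beta> = B\<close> both sides are
  equal.\<close>

lemma sibling_quadratic: "\<beta> * (\<alpha> - \<beta>) \<le> B * (\<alpha> * (\<alpha> - \<beta>) + \<beta> * \<beta> * (1 - \<alpha>))"
proof -
  define d where "d = \<beta> - B"
  have "0 \<le> B * ((1 + B) * (1 + B) * (1 - 2 * B)) * d + (1 + B * (1 - \<alpha>)) * (d * d)"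
    using B_bounds beta_bounds alpha_less by (auto simp: d_def intro!: add_nonneg_nonneg mult_nonneg_nonneg)
  also have "\<dots> = B * (\<alpha> * (\<alpha> - \<beta>) + \<beta> * \<beta> * (1 - \<alpha>)) - \<beta> * (\<alpha> - \<beta>)"
    unfolding d_def alpha_B by algebra
  finally show ?thesis by simp
qed

text \<open>After a double rotation this bounds the grandchildren lying inside \<open>r\<close>. The
  child and grandchild conditions give two lower bounds on \<open>n122\<close>, namely
  \<open>(1 - \<alpha>) * n12\<close> and \<open>n12 - \<beta> * n1\<close>. They are combined with
  the weights \<open>\<beta> * \<beta> - \<theta>\<close> and \<open>\<theta>\<close>, which makes
  the \<open>n1\<close> terms cancel against the hypothesis on \<open>n12\<close>.\<close>

lemma sibling_bound:
  assumes "B * (n1 + n2) < n12" "n12 = n121 + n122" "n121 \<le> \<beta> * n1" "n121 \<le> \<alpha> * n12"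
    and "0 < n1" "0 < n2"
  shows "(\<alpha> - \<beta>) * n2 \<le> \<beta> * n122"
proof -
  define \<theta> where "\<theta> = \<alpha> - \<beta>"
  have th: "0 \<le> \<theta>" "\<theta> \<le> \<beta> * \<beta>"
    using alpha_beta_less alpha_minus_beta_le mult_mono[of B \<beta> B \<beta>] B_bounds beta_bounds
    by (auto simp: \<theta>_def)
  have "\<theta> * (n12 - \<beta> * n1) \<le> \<theta> * n122" "(\<beta> * \<beta> - \<theta>) * ((1 - \<alpha>) * n12) \<le> (\<beta> * \<beta> - \<theta>) * n122"
    by (rule mult_left_mono; use th assms in \<open>simp add: algebra_simps\<close>)+
  then have "n12 * (\<alpha> * \<theta> + \<beta> * \<beta> * (1 - \<alpha>)) - \<theta> * \<beta> * n1 \<le> \<beta> * \<beta> * n122"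
    by (simp add: algebra_simps)
  moreover have "B * (n1 + n2) * (\<alpha> * \<theta> + \<beta> * \<beta> * (1 - \<alpha>)) \<le> n12 * (\<alpha> * \<theta> + \<beta> * \<beta> * (1 - \<alpha>))"
    using assms th param_bounds by (intro mult_right_mono add_nonneg_nonneg mult_nonneg_nonneg) auto
  moreover have "\<beta> * \<theta> * (n1 + n2) \<le> B * (\<alpha> * \<theta> + \<beta> * \<beta> * (1 - \<alpha>)) * (n1 + n2)"
    using sibling_quadratic assms unfolding \<theta>_def by (intro mult_right_mono) auto
  ultimately have "\<beta> * (\<theta> * n2) \<le> \<beta> * (\<beta> * n122)"
    by (simp add: algebra_simps)
  then show ?thesis using param_bounds unfolding \<theta>_def by simp
qed

lemma GC_drot:
  assumes "alm \<alpha> t" "y * wt t [] < wt t [L, R]"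
  shows "bal (drot t) \<and> heavy (drot t) \<le> heavy t"
proof -
  obtain l a r where t: "t = \<langle>l, a, r\<rangle>"
    using assms param_bounds by (cases t) (auto simp: power2_eq_square)
  have yn: "B * wt t [] < wt t [L, R]"
    using assms(2) param_bounds mult_right_mono[of B y "wt t []"] wt_pos[of t "[]"] by linarith
  have Bwt: "478 / 1000 * wt t [] \<le> B * wt t []"
    using param_bounds wt_pos[of t "[]"] by (intro mult_right_mono) auto
  have "2 \<le> wt t []" using wt_Nil_ge_1[of l] wt_Nil_ge_1[of r] by (simp add: t)
  then have "1 / 2 < B * wt t []"
    using Bwt by linarith
  then obtain t11 b t12 where l: "l = \<langle>t11, b, t12\<rangle>"
    using yn by (cases l) (auto simp: t)
  \<comment> \<open>The root and \<open>l\<close> are nodes, so the tree weighs at least 3, and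
    \<open>0.478 * 3 > 1\<close> shows that the heavy grandchild is a node too.\<close>
  have "3 \<le> wt t []"
    using wt_Nil_ge_1[of t11] wt_Nil_ge_1[of t12] wt_Nil_ge_1[of r] by (simp add: t l)
  then have "1 < wt t12 []"
    using yn Bwt by (simp add: t l)
  then obtain t121 c t122 where t12: "t12 = \<langle>t121, c, t122\<rangle>"
    using not_Leaf_if_wt_gt_1 by blast
  define n11 n121 n122 n2 where n: "n11 = wt t11 []" "n121 = wt t121 []" "n122 = wt t122 []"
    "n2 = wt r []"
  define n12 where n12: "n12 = n121 + n122"
  define n1 where n1_def: "n1 = n11 + n12"
  have pos: "0 < n11" "0 < n121" "0 < n122" "0 < n2" "0 < n1" "0 < n12"
    unfolding n n12 n1_def by (auto intro: wt_pos add_pos_pos)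
  have b: "bal t11" "bal t12" "bal r" "bal l" "C_bal \<alpha> t" "bal t121" "bal t122"
    using assms(1) by (auto simp: almost_def t l t12)
  have n1: "n1 \<le> \<alpha> * (n1 + n2)" and n2: "n2 \<le> \<alpha> * (n1 + n2)"
    using b(5) by (auto simp: C_bal_def t l t12 n n12 n1_def algebra_simps)
  have c: "n11 \<le> \<alpha> * n1" "n12 \<le> \<alpha> * n1" "n121 \<le> \<alpha> * n12" "n122 \<le> \<alpha> * n12"
    using bal_C_bal[OF b(4)] bal_C_bal[OF b(2)]
    by (auto simp: C_bal_def l t12 n n12 n1_def algebra_simps)
  have c': "(1 - \<alpha>) * n1 \<le> n11" "(1 - \<alpha>) * n12 \<le> n121" "(1 - \<alpha>) * n12 \<le> n122"
    using c by (simp_all add: n12 n1_def algebra_simps)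
  have g: "n121 \<le> \<beta> * n1" "n122 \<le> \<beta> * n1"
    using bal_GC_bal[OF b(4)] by (auto simp: GC_bal_def l t12 n n12 n1_def algebra_simps)
  have d: "wt t11 [L] \<le> \<alpha> * n11" "wt t11 [R] \<le> \<alpha> * n11"
    "wt t121 [L] \<le> \<alpha> * n121" "wt t121 [R] \<le> \<alpha> * n121"
    "wt t122 [L] \<le> \<alpha> * n122" "wt t122 [R] \<le> \<alpha> * n122"
    "wt r [L] \<le> \<alpha> * n2" "wt r [R] \<le> \<alpha> * n2"
    using bal_C_bal[OF b(1)] bal_C_bal[OF b(3)] bal_C_bal[OF b(6)] bal_C_bal[OF b(7)]
    by (auto simp: C_bal_def n)
  have h: "B * (n1 + n2) < n12"
    using yn by (simp add: t l t12 n n12 n1_def algebra_simps)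
  note h1 = n1_le_n2[OF n1]
  have h2: "n2 < B * n1" using heavy_parent[OF h] c by simp
  have h3: "n11 < B * n12" "n11 < B * B * (n1 + n2)"
    using light_sibling[OF n1 h] by (auto simp: n1_def)
  have Bn: "478 / 1000 * (n1 + n2) \<le> B * (n1 + n2)" "7071/10000 * (n1 + n2) \<le> \<alpha> * (n1 + n2)"
    "7071/10000 * n12 \<le> \<alpha> * n12" "478 / 1000 * n2 \<le> B * n2"
    by (rule mult_right_mono; use param_bounds pos in simp)+
  have h4: "n2 \<le> n12"
  proof -
    have "B * n1 \<le> 1 / 2 * n1" "\<alpha> * (n1 + n2) \<le> 3 / 4 * (n1 + n2)"
      by (rule mult_right_mono; use param_bounds pos in simp)+
    then show ?thesis using h h2 Bn n1 pos by linarith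
  qed
  have h5: "n2 \<le> \<alpha> * n12"
  proof -
    \<comment> \<open>Together these give \<open>n12 > (1 + B) * n2\<close>, and
      \<open>1 / 1.478 < 0.7071\<close>.\<close>
    have "B * n1 > n2" by (rule h2)
    moreover have "B * n1 + B * n2 < n12" using h by (simp add: distrib_left)
    ultimately have "1478 / 1000 * n2 < n12" using Bn(4) by linarith
    then show ?thesis using Bn(3) pos by linarith
  qed
  have e1: "B * n12 \<le> B * n1" "B * n1 \<le> \<beta> * n1" "\<beta> * n1 \<le> \<beta> * (n1 + n2)" "B * n12 \<le> \<alpha> * n12"
    using param_bounds pos by (auto intro!: mult_mono simp: n1_def)
  have "C_bal \<alpha> (drot t)"
  proof -
    have "(1 - \<alpha>) * n2 \<le> (1 - \<alpha>) * n12"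
      using param_bounds h4 by (intro mult_left_mono) auto
    then have "n122 + n2 \<le> \<alpha> * (n1 + n2)"
      using c' by (simp add: algebra_simps n1_def n12)
    moreover have "n11 + n121 \<le> \<alpha> * (n1 + n2)"
      using n1 pos by (simp add: n12 n1_def)
    ultimately show ?thesis
      by (simp add: C_bal_def t l t12 n n12 n1_def algebra_simps)
  qed
  moreover have "GC_bal \<beta> (drot t)"
  proof -
    have "wt t11 [] \<le> \<beta> * wt t [] \<and> wt t121 [] \<le> \<beta> * wt t [] \<and> wt t122 [] \<le> \<beta> * wt t [] \<and> wt r [] \<le> \<beta> * wt t []"
      using g h2 h3 e1 by (simp add: t l t12 n n12 n1_def add.assoc)
    then show ?thesis by (simp add: GC_bal_def t l t12 algebra_simps)
  qed
  moreover have "C_bal \<alpha> \<langle>t11, b, t121\<rangle>"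
  proof -
    have "(1 - \<alpha>) * n11 \<le> (1 - \<alpha>) * (\<alpha> * n12)" "\<alpha> * ((1 - \<alpha>) * n12) \<le> \<alpha> * n121"
      "(1 - \<alpha>) * n121 \<le> (1 - \<alpha>) * (\<alpha> * n12)" "\<alpha> * ((1 - \<alpha>) * n12) \<le> \<alpha> * ((1 - \<alpha>) * n1)"
      "\<alpha> * ((1 - \<alpha>) * n1) \<le> \<alpha> * n11"
      using param_bounds pos order.trans[OF less_imp_le[OF h3(1)] e1(4)] c c' by (auto intro!: mult_left_mono simp: n1_def)
    then show ?thesis by (simp add: C_bal_def flip: n) (simp add: algebra_simps)
  qed
  moreover have "GC_bal \<beta> \<langle>t11, b, t121\<rangle>"
  proof -
    have "(\<alpha> - \<beta>) * n11 \<le> B * B * (B * n12)"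
      using alpha_minus_beta_le h3 pos param_bounds by (intro mult_mono) auto
    moreover have "B * (B * B * n12) \<le> \<beta> * ((1 - \<alpha>) * n12)"
      using B_sq_le param_bounds pos by (intro mult_mono) auto
    moreover have "\<beta> * ((1 - \<alpha>) * n12) \<le> \<beta> * n121"
      using c' param_bounds by (intro mult_left_mono) auto
    ultimately have 1: "\<alpha> * n11 \<le> \<beta> * (n11 + n121)"
      by (simp add: algebra_simps)
    have "(\<alpha> - \<beta>) * n121 \<le> (1 - \<alpha>) * (\<beta> * n1)"
      using alpha_minus_beta_le B_sq_le g pos param_bounds by (intro mult_mono) auto
    moreover have "\<beta> * ((1 - \<alpha>) * n1) \<le> \<beta> * n11"
      using c' param_bounds by (intro mult_left_mono) auto
    ultimately have 2: "\<alpha> * n121 \<le> \<beta> * (n11 + n121)"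
      by (simp add: algebra_simps)
    show ?thesis using 1 2 d by (simp add: GC_bal_def flip: n)
  qed
  moreover have "C_bal \<alpha> \<langle>t122, a, r\<rangle>"
  proof -
    have "\<beta> * n1 \<le> \<alpha> * n1" using param_bounds pos by (intro mult_right_mono) auto
    then have "n122 \<le> \<alpha> * n1" using g by linarith
    then have "(1 - \<alpha>) * n122 \<le> (1 - \<alpha>) * (\<alpha> * n1)"
      "\<alpha> * ((1 - \<alpha>) * n1) \<le> \<alpha> * (\<alpha> * n2)" "\<alpha> * (\<alpha> * n2) \<le> \<alpha> * n2"
      "(1 - \<alpha>) * n2 \<le> (1 - \<alpha>) * (\<alpha> * n12)" "\<alpha> * ((1 - \<alpha>) * n12) \<le> \<alpha> * n122"
      using param_bounds pos h1 h5 c'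
      by (auto intro!: mult_left_mono simp: mult_le_cancel_right1)
    then show ?thesis by (simp add: C_bal_def flip: n) (simp add: algebra_simps)
  qed
  moreover have "GC_bal \<beta> \<langle>t122, a, r\<rangle>"
  proof -
    have "(\<alpha> - \<beta>) * n122 \<le> (1 - \<alpha>) * (\<beta> * n1)"
      using alpha_minus_beta_le B_sq_le g pos param_bounds by (intro mult_mono) auto
    moreover have "\<beta> * ((1 - \<alpha>) * n1) \<le> \<beta> * (\<alpha> * n2)"
      using param_bounds h1 by (intro mult_left_mono) auto
    moreover have "\<beta> * (\<alpha> * n2) \<le> \<beta> * n2"
      using param_bounds pos by (intro mult_left_mono) (auto simp: mult_le_cancel_right1)
    ultimately have 1: "\<alpha> * n122 \<le> \<beta> * (n122 + n2)"
      by (simp add: algebra_simps)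
    have 2: "\<alpha> * n2 \<le> \<beta> * (n122 + n2)"
      using sibling_bound[OF h n12 g(1) c(3)] pos by (simp add: algebra_simps)
    show ?thesis using 1 2 d by (simp add: GC_bal_def flip: n)
  qed
  moreover have "heavy (drot t) \<le> heavy t"
  proof -
    \<comment> \<open>As \<open>n122 \<le> \<beta> * n1\<close>, the goal
      \<open>n122 + n2 \<le> n1\<close> follows from
      \<open>n1 + n2 \<le> (2 - \<beta>) * n1\<close>. This is the purpose of the bound
      \<open>\<alpha> \<le> y * (2 - \<beta>)\<close>.\<close>
    have "\<alpha> * (n1 + n2) \<le> y * (2 - \<beta>) * (n1 + n2)"
      using y_bounds pos by (intro mult_right_mono) auto
    also have "\<dots> = (2 - \<beta>) * (y * (n1 + n2))" by simp
    also have "\<dots> \<le> (2 - \<beta>) * (\<alpha> * n1)"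
      using assms(2) c param_bounds by (intro mult_left_mono) (auto simp: t l t12 n n12 n1_def algebra_simps)
    finally have "\<alpha> * (n1 + n2) \<le> \<alpha> * ((2 - \<beta>) * n1)" by (simp add: algebra_simps)
    then have "n1 + n2 \<le> (2 - \<beta>) * n1" using param_bounds by simp
    then have "n122 + n2 \<le> n1" using g by (simp add: algebra_simps)
    moreover have "n11 + n121 \<le> n1" using pos by (simp add: n1_def n12)
    ultimately show ?thesis by (simp add: t l t12 heavy_Node n n12 n1_def add.assoc)
  qed
  ultimately show ?thesis
    using b by (simp add: t l t12)
qed

lemma GC_balance_balanced:
  assumes "alm \<alpha> t"
  shows "bal (GC_balance y 0 t) \<and> heavy (GC_balance y 0 t) \<le> heavy t"
proof -
  consider (rot) "GC_balance y 0 t = rot t" "y * wt t [] < wt t [L, L]"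
    | (rot_mirror) "GC_balance y 0 t = rot_mirror t" "y * wt t [] < wt t [R, R]"
    | (drot) "GC_balance y 0 t = drot t" "y * wt t [] < wt t [L, R]"
    | (drot_mirror) "GC_balance y 0 t = drot_mirror t" "y * wt t [] < wt t [R, L]"
    | (none) "GC_balance y 0 t = t" "GC_bal y t"
    unfolding GC_balance_def GC_bal_def by (smt (verit))
  then show ?thesis
  proof cases
    case none
    have "y * wt t [] \<le> \<beta> * wt t []"
      using y_bounds wt_pos[of t "[]"] by (intro mult_right_mono) auto
    then have "GC_bal \<beta> t" using none by (auto simp: GC_bal_def)
    then show ?thesis using none assms by (cases t) (auto simp: almost_def)
  qed (use GC_rot[of t] GC_rot[of "mirror t"] GC_drot[of t] GC_drot[of "mirror t"] assms in
    \<open>auto simp: rot_mirror_eq drot_mirror_eq wt_mirror\<close>)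
qed

end

section \<open>Rotations for children that are too heavy\<close>

text \<open>The composite algorithms branch on whether the tree has changed, so a rotation that is
  performed must be visible. Equality would make \<open>t11\<close> a proper part of itself.\<close>

lemma rot_neq: "rot \<langle>\<langle>t11, b, t12\<rangle>, a, r\<rangle> \<noteq> \<langle>\<langle>t11, b, t12\<rangle>, a, r\<rangle>"
  by (auto dest: arg_cong[of _ _ size])

lemma drot_neq: "drot \<langle>\<langle>t11, b, \<langle>t121, c, t122\<rangle>\<rangle>, a, r\<rangle> \<noteq> \<langle>\<langle>t11, b, \<langle>t121, c, t122\<rangle>\<rangle>, a, r\<rangle>"
  by (auto dest: arg_cong[of _ _ size])

lemma C_balance_cases:
  obtains (rot) "C_balance u v w x t = rot t" "u * wt t [] + w < wt t [L]"
      "(1 - v) * wt t [] - x \<le> wt t [L, L]"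
    | (rot_mirror) "C_balance u v w x t = rot_mirror t" "u * wt t [] + w < wt t [R]"
      "(1 - v) * wt t [] - x \<le> wt t [R, R]"
    | (drot) "C_balance u v w x t = drot t" "u * wt t [] + w < wt t [L]"
      "wt t [L, L] < (1 - v) * wt t [] - x"
    | (drot_mirror) "C_balance u v w x t = drot_mirror t" "u * wt t [] + w < wt t [R]"
      "wt t [R, R] < (1 - v) * wt t [] - x"
    | (none) "C_balance u v w x t = t" "wt t [L] \<le> u * wt t [] + w" "wt t [R] \<le> u * wt t [] + w"
  unfolding C_balance_def by (smt (verit))

lemma GC_balance_cases:
  obtains (rot) "GC_balance y z t = rot t" "y * wt t [] + z < wt t [L, L]"
    | (rot_mirror) "GC_balance y z t = rot_mirror t" "y * wt t [] + z < wt t [R, R]"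
    | (drot) "GC_balance y z t = drot t" "y * wt t [] + z < wt t [L, R]"
    | (drot_mirror) "GC_balance y z t = drot_mirror t" "y * wt t [] + z < wt t [R, L]"
    | (none) "GC_balance y z t = t" "wt t [L, L] \<le> y * wt t [] + z" "wt t [L, R] \<le> y * wt t [] + z"
      "wt t [R, L] \<le> y * wt t [] + z" "wt t [R, R] \<le> y * wt t [] + z"
  unfolding GC_balance_def by (smt (verit))

text \<open>What a rotation leaves behind. The bound \<open>m\<close> is a weight and not a
  fraction, since it is \<open>\<alpha> * n\<close> inside the tree but
  \<open>\<alpha> * (n - 1)\<close> at the root of a large tree of weight \<open>n\<close>.\<close>

definition almost_children :: "real \<Rightarrow> real \<Rightarrow> real \<Rightarrow> real \<Rightarrow> 'a tree \<Rightarrow> bool" where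
  "almost_children x y z m t \<longleftrightarrow> heavy t \<le> m \<and>
    (\<exists>l a r. t = \<langle>l, a, r\<rangle> \<and> almost x y z l \<and> almost x y z r)"

lemma almost_children_mirror [simp]:
  "almost_children x y z m (mirror t) = almost_children x y z m t"
  unfolding almost_children_def mirror_eq_Node by (auto; metis almost_mirror mirror_mirror)

context gcb_params begin

text \<open>\<open>x * (1 - x)\<close> decreases beyond 1/2, so its value at 0.7071 is decisive. The
  result stays below 0.21, the least share of a child under \<open>C_bal (79/100)\<close>.\<close>

lemma alpha_quad: "\<alpha> * (1 - \<alpha>) \<le> 2072 / 10000" "v * (1 - \<alpha>) \<le> 2072 / 10000"
proof -
  have "0 \<le> (\<alpha> - 7071/10000) * (\<alpha> - 2929/10000)"
    using param_bounds by (intro mult_nonneg_nonneg) auto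
  then show *: "\<alpha> * (1 - \<alpha>) \<le> 2072 / 10000" by (simp add: algebra_simps)
  have "v * (1 - \<alpha>) \<le> \<alpha> * (1 - \<alpha>)" using param_bounds by (intro mult_right_mono) auto
  with * show "v * (1 - \<alpha>) \<le> 2072 / 10000" by simp
qed

text \<open>The constant \<open>79/100\<close> is large enough for the children produced by rotations at a root of weight
  at least 31, and below \<open>1 - \<alpha> (1 - \<alpha>)\<close>, so that a single rotation suffices to repair them.\<close>

lemma C_rot:
  assumes "alm (79/100) t" "v * wt t [] < wt t [L]" "(1 - v) * wt t [] \<le> wt t [L, L]"
  shows "almost_children \<alpha> \<beta> \<alpha> (\<alpha> * wt t []) (rot t) \<and> heavy (rot t) \<le> heavy t \<and> rot t \<noteq> t"
proof -
  obtain l a r where t: "t = \<langle>l, a, r\<rangle>"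
    using assms param_bounds by (cases t) auto
  have "7 / 10 * wt t [] < wt t [L]"
    using assms(2) param_bounds mult_right_mono[of "7/10" v "wt t []"] wt_pos[of t "[]"] by linarith
  then have "1 < wt l []"
    using wt_Nil_ge_1[of r] wt_Nil_ge_1[of l] by (simp add: t)
  then obtain t11 b t12 where l: "l = \<langle>t11, b, t12\<rangle>"
    using not_Leaf_if_wt_gt_1 by blast
  define n11 n12 n2 where n: "n11 = wt t11 []" "n12 = wt t12 []" "n2 = wt r []"
  define n1 where "n1 = n11 + n12"
  define m where m_def: "m = n1 + n2"
  have pos: "0 < n11" "0 < n12" "0 < n2" "0 < n1" "0 < m"
    unfolding n n1_def m_def by (auto intro: wt_pos add_pos_pos)
  have b: "bal t11" "bal t12" "bal r" "bal l" "C_bal (79/100) t"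
    using assms(1) by (auto simp: almost_def t l)
  have m: "wt t [] = m" "n11 + (n12 + n2) = m"
    by (simp_all add: t l n n1_def m_def)
  have n2: "21 / 100 * m \<le> n2" "n1 \<le> 79 / 100 * m"
    using b(5) by (auto simp: C_bal_def m) (auto simp: m_def n n1_def t l algebra_simps)
  have c: "n11 \<le> \<alpha> * n1" "n12 \<le> \<alpha> * n1"
    using bal_C_bal[OF b(4)] by (auto simp: C_bal_def l n n1_def)
  have c': "(1 - \<alpha>) * n1 \<le> n12"
    using c by (simp add: n1_def algebra_simps)
  have h: "v * m < n1" "(1 - v) * m \<le> n11"
    using assms(2,3) unfolding m by (auto simp: t l n n1_def)
  have e: "7 / 10 * m \<le> v * m" "v * m \<le> \<alpha> * m" "7071/10000 * n1 \<le> \<alpha> * n1"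
    by (rule mult_right_mono; use param_bounds pos in simp)+
  have h': "n12 + n2 \<le> v * m"
    using h(2) m(2) by (simp add: algebra_simps)
  have n2': "n2 \<le> \<alpha> * n1"
    using e h m_def pos by linarith
  have "C_bal \<alpha> \<langle>t12, a, r\<rangle>"
  proof -
    \<comment> \<open>The new right child weighs at most \<open>v * m\<close>, so its fraction
      \<open>1 - \<alpha>\<close> is at most \<open>0.2072 * m\<close>, less than the
      \<open>0.21 * m\<close> held by \<open>r\<close>.\<close>
    have "(1 - \<alpha>) * (n12 + n2) \<le> (1 - \<alpha>) * (v * m)" "(1 - \<alpha>) * n2 \<le> (1 - \<alpha>) * (\<alpha> * n1)"
      "\<alpha> * ((1 - \<alpha>) * n1) \<le> \<alpha> * n12"
      using param_bounds h' n2' c' by (auto intro!: mult_left_mono)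
    moreover have "(1 - \<alpha>) * (v * m) \<le> 2072 / 10000 * m"
      using mult_right_mono[OF alpha_quad(2), of m] pos by (simp add: mult_ac)
    ultimately have "(1 - \<alpha>) * (n12 + n2) \<le> n2" "(1 - \<alpha>) * n2 \<le> \<alpha> * n12"
      using n2 pos mult.left_commute[of "1 - \<alpha>" \<alpha> n1] by linarith+
    then show ?thesis
      by (simp add: C_bal_def flip: n) (simp add: algebra_simps)
  qed
  then have "alm \<alpha> \<langle>t12, a, r\<rangle>" using b by (simp add: almost_def)
  moreover have "heavy (rot t) \<le> \<alpha> * m" "heavy (rot t) \<le> heavy t"
  proof -
    have "n11 \<le> 79/100 * m * (75/100)"
      using c(1) mult_mono[of \<alpha> "75/100" n1 "79/100 * m"] n2 param_bounds pos by simp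
    then have "n11 \<le> \<alpha> * m" "n12 + n2 \<le> \<alpha> * m" "n11 \<le> n1" "n12 + n2 \<le> n1"
      using e h' h pos n1_def by linarith+
    then show "heavy (rot t) \<le> \<alpha> * m" "heavy (rot t) \<le> heavy t"
      by (simp_all add: t l heavy_Node n n1_def)
  qed
  ultimately show ?thesis
    using rot_neq bal_almost[OF b(1)] by (simp add: almost_children_def m) (simp add: t l)
qed

lemma C_drot:
  assumes "alm (79/100) t" "v * wt t [] < wt t [L]" "wt t [L, L] < (1 - v) * wt t []"
  shows "almost_children \<alpha> \<beta> \<alpha> (\<alpha> * wt t []) (drot t) \<and> heavy (drot t) \<le> heavy t \<and> drot t \<noteq> t"
proof -
  obtain l a r where t: "t = \<langle>l, a, r\<rangle>"
    using assms param_bounds by (cases t) auto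
  have "7 / 10 * wt t [] \<le> v * wt t []"
    using param_bounds wt_pos[of t "[]"] by (intro mult_right_mono) auto
  then have vw: "7 / 10 * wt t [] < wt t [L]" "wt t [L, L] < 3 / 10 * wt t []"
    using assms(2,3) unfolding left_diff_distrib by linarith+
  then have "1 < wt l []"
    using wt_Nil_ge_1[of r] wt_Nil_ge_1[of l] by (simp add: t)
  then obtain t11 b t12 where l: "l = \<langle>t11, b, t12\<rangle>"
    using not_Leaf_if_wt_gt_1 by blast
  have "1 < wt t12 []"
    using vw wt_Nil_ge_1[of t11] wt_Nil_ge_1[of t12] wt_Nil_ge_1[of r] by (simp add: t l)
  then obtain t121 c t122 where t12: "t12 = \<langle>t121, c, t122\<rangle>"
    using not_Leaf_if_wt_gt_1 by blast
  define n11 n121 n122 n2 where n: "n11 = wt t11 []" "n121 = wt t121 []" "n122 = wt t122 []"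
    "n2 = wt r []"
  define n12 where n12: "n12 = n121 + n122"
  define n1 where n1_def: "n1 = n11 + n12"
  define m where m_def: "m = n1 + n2"
  have pos: "0 < n11" "0 < n121" "0 < n122" "0 < n2" "0 < n1" "0 < n12" "0 < m"
    unfolding n n12 n1_def m_def by (auto intro: wt_pos add_pos_pos)
  have b: "bal t11" "bal t12" "bal r" "bal l" "C_bal (79/100) t" "bal t121" "bal t122"
    using assms(1) by (auto simp: almost_def t l t12)
  have m: "wt t [] = m"
    by (simp_all add: t l t12 n n12 n1_def m_def)
  have n2: "21 / 100 * m \<le> n2" "n1 \<le> 79 / 100 * m"
    using b(5) by (auto simp: C_bal_def m) (auto simp: m_def n n12 n1_def t l t12 algebra_simps)
  have c: "n11 \<le> \<alpha> * n1" "n12 \<le> \<alpha> * n1" "n121 \<le> \<alpha> * n12" "n122 \<le> \<alpha> * n12"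
    using bal_C_bal[OF b(4)] bal_C_bal[OF b(2)]
    by (auto simp: C_bal_def l t12 n n12 n1_def algebra_simps)
  have c': "(1 - \<alpha>) * n1 \<le> n11" "(1 - \<alpha>) * n12 \<le> n121" "(1 - \<alpha>) * n12 \<le> n122"
    using c by (simp_all add: n12 n1_def algebra_simps)
  have h: "v * m < n1" "n11 < (1 - v) * m"
    using assms(2,3) unfolding m by (auto simp: t l t12 n n12 n1_def)
  have e: "7 / 10 * m \<le> v * m" "v * m \<le> \<alpha> * m" "7071/10000 * m \<le> \<alpha> * m" "n12 \<le> n1"
    by (rule mult_right_mono; use param_bounds pos in simp)+ (use pos in \<open>simp add: n1_def\<close>)
  text \<open>This is where \<open>v \<ge> (1 + \<alpha>) / (1 + 2 \<alpha>)\<close> is needed.\<close>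
  have k: "(1 - v) * m \<le> \<alpha> * n12"
  proof -
    have "(1 + \<alpha>) * m \<le> v * (1 + 2 * \<alpha>) * m"
      using v_bounds pos by (intro mult_right_mono) auto
    moreover have "\<alpha> * ((2 * v - 1) * m) \<le> \<alpha> * n12"
      using param_bounds h by (intro mult_left_mono) (auto simp: n1_def algebra_simps)
    ultimately show ?thesis by (simp add: algebra_simps)
  qed
  have "n2 < (1 - v) * m"
    using h by (simp add: m_def algebra_simps)
  then have k': "n11 \<le> \<alpha> * n12" "n2 \<le> \<alpha> * n12" using k h by auto
  have "C_bal \<alpha> \<langle>t11, b, t121\<rangle>"
  proof -
    have "(1 - \<alpha>) * n11 \<le> (1 - \<alpha>) * (\<alpha> * n12)" "\<alpha> * ((1 - \<alpha>) * n12) \<le> \<alpha> * n121"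
      "(1 - \<alpha>) * n121 \<le> (1 - \<alpha>) * (\<alpha> * n12)" "\<alpha> * ((1 - \<alpha>) * n12) \<le> \<alpha> * ((1 - \<alpha>) * n1)"
      "\<alpha> * ((1 - \<alpha>) * n1) \<le> \<alpha> * n11"
      using param_bounds e k' c c' by (auto intro!: mult_left_mono)
    then show ?thesis by (simp add: C_bal_def flip: n) (simp add: algebra_simps)
  qed
  moreover have "C_bal \<alpha> \<langle>t122, a, r\<rangle>"
  proof -
    \<comment> \<open>The first inequality below rests on
      \<open>0.2072 * 0.75 * 0.79 < 0.7071 * 0.21\<close>.\<close>
    have "n12 \<le> 75 / 100 * n1"
      using order.trans[OF c(2) mult_right_mono[of \<alpha> "75 / 100" n1]] param_bounds pos by simp
    moreover have "(1 - \<alpha>) * (\<alpha> * n12) \<le> 2072 / 10000 * n12"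
      using mult_right_mono[OF alpha_quad(1), of n12] pos by (simp add: mult_ac)
    moreover have "(1 - \<alpha>) * n122 \<le> (1 - \<alpha>) * (\<alpha> * n12)" "(1 - \<alpha>) * n2 \<le> (1 - \<alpha>) * (\<alpha> * n12)"
      "\<alpha> * ((1 - \<alpha>) * n12) \<le> \<alpha> * n122"
      using param_bounds k' c' c by (auto intro!: mult_left_mono)
    moreover have "7071/10000 * n2 \<le> \<alpha> * n2"
      using param_bounds pos by (intro mult_right_mono) auto
    ultimately have "(1 - \<alpha>) * n122 \<le> \<alpha> * n2" "(1 - \<alpha>) * n2 \<le> \<alpha> * n122"
      using n2 pos mult.left_commute[of "1 - \<alpha>" \<alpha> n12] by linarith+
    then show ?thesis by (simp add: C_bal_def flip: n) (simp add: algebra_simps)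
  qed
  moreover have "heavy (drot t) \<le> \<alpha> * m" "heavy (drot t) \<le> heavy t"
  proof -
    \<comment> \<open>Here \<open>n122 + n2 \<le> n1\<close> comes down to
      \<open>m \<le> 23/16 * n1\<close>, which follows from \<open>n1 > 0.7 * m\<close> as
      \<open>23/16 * 0.7 > 1\<close>.\<close>
    have "n122 \<le> \<beta> * n1" using bal_GC_bal[OF b(4)]
      by (auto simp: GC_bal_def l t12 n n12 n1_def algebra_simps)
    also have "\<dots> \<le> 9 / 16 * n1" using param_bounds pos by (intro mult_right_mono) auto
    finally have *: "n122 + n2 \<le> m - 7 / 16 * n1" by (simp add: m_def)
    then have "n122 + n2 \<le> \<alpha> * m" "n122 + n2 \<le> n1" "n11 + n121 \<le> n1"
      using e h pos n12 n1_def by linarith+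
    moreover have "n11 + n121 \<le> \<alpha> * m"
    proof -
      have "25 / 100 * n12 \<le> (1 - \<alpha>) * n12" using param_bounds pos by (intro mult_right_mono) auto
      then have "n11 + n121 \<le> n1 - 25 / 100 * n12" using c' by (simp add: n1_def n12)
      moreover have "n11 \<le> 3 / 10 * m" using h e by (simp add: algebra_simps)
      ultimately show ?thesis using n2 e h n1_def pos by linarith
    qed
    ultimately show "heavy (drot t) \<le> \<alpha> * m" "heavy (drot t) \<le> heavy t"
      by (simp_all add: t l t12 heavy_Node n n1_def n12 add.assoc)
  qed
  ultimately show ?thesis
    using drot_neq b by (simp add: almost_children_def m) (simp add: t l t12 almost_def)
qed

lemma C_balance_almost:
  assumes "alm (79/100) t"
  defines "s \<equiv> C_balance v v 0 0 t"
  shows "s = t \<and> alm \<alpha> t \<or> s \<noteq> t \<and> almost_children \<alpha> \<beta> \<alpha> (\<alpha> * wt t []) s \<and> heavy s \<le> heavy t"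
proof (cases rule: C_balance_cases[of v v 0 0 t])
  case none
  then have "C_bal \<alpha> t"
    using mult_right_mono[OF v_bounds(2), of "wt t []"] wt_pos[of t "[]"]
    unfolding C_bal_def by linarith
  then show ?thesis using none assms by (auto simp: almost_def)
next
  case rot_mirror
  have "rot_mirror t \<noteq> t" if "rot (mirror t) \<noteq> mirror t"
    using that by (metis rot_mirror_eq mirror_mirror)
  then show ?thesis using rot_mirror C_rot[of "mirror t"] assms
    by (auto simp: rot_mirror_eq wt_mirror)
next
  case drot_mirror
  have "drot_mirror t \<noteq> t" if "drot (mirror t) \<noteq> mirror t"
    using that by (metis drot_mirror_eq mirror_mirror)
  then show ?thesis using drot_mirror C_drot[of "mirror t"] assms
    by (auto simp: drot_mirror_eq wt_mirror)
qed (use C_rot[of t] C_drot[of t] assms in auto)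

lemma wt_GC_balance [simp]: "wt (GC_balance y' z t) [] = wt t []"
  by (simp add: wt_Nil size1_size)

lemma wt_CGC_balance [simp]: "wt (CGC_balance u' v' x' y' t) [] = wt t []"
  by (simp add: wt_Nil size1_size)

text \<open>GC-balancing the children does not alter their weights, so the child condition obtained
  by the rotation persists and the tree becomes \<open>alm \<alpha>\<close>, as the final
  GC-balancing requires.\<close>

lemma CGC_balance_balanced:
  assumes "alm (79/100) t"
  shows "bal (CGC_balance v v y y t) \<and> heavy (CGC_balance v v y y t) \<le> heavy t"
proof -
  define s where "s = C_balance v v 0 0 t"
  consider "s = t" "alm \<alpha> t"
    | "s \<noteq> t" "almost_children \<alpha> \<beta> \<alpha> (\<alpha> * wt t []) s" "heavy s \<le> heavy t"
    using C_balance_almost[OF assms] unfolding s_def by blast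
  then show ?thesis
  proof cases
    case 1
    then show ?thesis using GC_balance_balanced[of t]
      by (auto simp: CGC_balance_def Let_def s_def)
  next
    case 2
    obtain l a r where s: "s = \<langle>l, a, r\<rangle>" "alm \<alpha> l" "alm \<alpha> r"
      using 2 by (auto simp: almost_children_def)
    have st: "wt s [] = wt t []" by (simp add: wt_Nil size1_size s_def)
    define s' where "s' = \<langle>GC_balance y 0 l, a, GC_balance y 0 r\<rangle>"
    have "C_bal \<alpha> s'"
      using 2 st by (simp add: almost_children_def heavy_def C_bal_def s'_def s)
    then have "alm \<alpha> s'"
      using s GC_balance_balanced by (auto simp: almost_def s'_def)
    moreover have "heavy s' = heavy s" by (simp add: heavy_def s'_def s)
    moreover have "CGC_balance v v y y t = GC_balance y 0 s'"
      using 2 by (simp add: CGC_balance_def Let_def s'_def s flip: s_def)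
    ultimately show ?thesis
      using GC_balance_balanced[of s'] 2 by auto
  qed
qed

end

section \<open>Rotations at the root of a large tree\<close>

definition grand_le :: "real \<Rightarrow> 'a tree \<Rightarrow> bool" where
  "grand_le g t \<longleftrightarrow> wt t [L, L] \<le> g \<and> wt t [L, R] \<le> g \<and> wt t [R, L] \<le> g \<and> wt t [R, R] \<le> g"

lemma grand_le_mirror [simp]: "grand_le g (mirror t) = grand_le g t"
  by (auto simp: grand_le_def wt_mirror)

context gcb_params begin

lemma R_shift_large: "R_shift \<alpha> = - \<alpha>" "R_shift v = - v"
  using param_bounds by (auto simp: R_shift_def)

text \<open>The first bound feeds linear arithmetic; the second is a multiple of \<alpha>, so that
  \<alpha> can be cancelled in \<open>RGC_drot\<close>.\<close>

lemma R_shift_lower: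
  assumes "B \<le> z" "z \<le> \<beta>"
  shows "- (9/16) \<le> R_shift z" "- (3/4 * \<alpha>) \<le> R_shift z"
proof -
  have "\<alpha> * \<alpha> \<le> 3/4 * \<alpha>" using param_bounds by (intro mult_right_mono) auto
  then have "z \<le> 3/4 * \<alpha>" using assms beta_bounds by linarith
  then show "- (9/16) \<le> R_shift z" "- (3/4 * \<alpha>) \<le> R_shift z"
    using assms param_bounds beta_bounds by (auto simp: R_shift_def min_def)
qed

text \<open>The right-hand side is concave in \<alpha>, hence minimal at an end of the interval from
  0.7071 to 0.75.\<close>

lemma alpha_cubic: "106 / 100 \<le> \<alpha> * (2 - \<alpha> * \<alpha>)"
proof -
  have 1: "0 \<le> (10000 * \<alpha> - 7071) * (3 - 4 * \<alpha>)"
    using param_bounds by (intro mult_nonneg_nonneg) auto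
  then have "0 \<le> \<alpha> * ((10000 * \<alpha> - 7071) * (3 - 4 * \<alpha>))"
    using param_bounds by (intro mult_nonneg_nonneg) auto
  with 1 show ?thesis using alpha_greater by (simp add: algebra_simps)
qed

text \<open>The hypotheses are the shifted thresholds, with
  \<open>R_shift \<alpha> = - \<alpha>\<close> and \<open>R_shift v = - v\<close>. The shifts may
  spoil the \<alpha>-balance of the new child, but from weight 31 on not beyond 79/100.\<close>

lemma RC_rot:
  assumes "bal t" "31 \<le> wt t []" "\<alpha> * (wt t [] - 1) < wt t [L]"
    "(1 - v) * wt t [] + v \<le> wt t [L, L]"
  shows "almost_children \<alpha> \<beta> (79/100) (\<alpha> * (wt t [] - 1)) (rot t) \<and> rot t \<noteq> t"
proof -
  obtain l a r where t: "t = \<langle>l, a, r\<rangle>"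
    using assms param_bounds by (cases t) auto
  define m where "m = wt t []"
  have m31: "31 \<le> m" using assms m_def by simp
  have am: "7071/10000 * (m - 1) \<le> \<alpha> * (m - 1)" "\<alpha> * m \<le> 3/4 * m"
    "v * (m - 1) \<le> \<alpha> * (m - 1)" "\<alpha> * (m - 1) \<le> 3/4 * (m - 1)"
    by (rule mult_right_mono; use param_bounds m31 in simp)+
  have "1 < wt l []"
    using assms(3) am m31 by (simp add: t m_def)
  then obtain t11 b t12 where l: "l = \<langle>t11, b, t12\<rangle>"
    using not_Leaf_if_wt_gt_1 by blast
  define n11 n12 n2 where n: "n11 = wt t11 []" "n12 = wt t12 []" "n2 = wt r []"
  define n1 where "n1 = n11 + n12"
  have m: "m = n1 + n2" "wt t [] = m"
    by (simp_all add: m_def t l n1_def n)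
  have pos: "0 < n11" "0 < n12" "0 < n2" "0 < n1"
    unfolding n n1_def by (auto intro: wt_pos add_pos_pos)
  have b: "bal t11" "bal t12" "bal r" "bal l"
    using assms(1) by (auto simp: t l)
  have n1: "n1 \<le> \<alpha> * m"
    using bal_C_bal[OF assms(1)] by (auto simp: C_bal_def m) (auto simp: t l n n1_def)
  have c: "n11 \<le> \<alpha> * n1" "n12 \<le> \<alpha> * n1"
    using bal_C_bal[OF b(4)] by (auto simp: C_bal_def l n n1_def)
  have an1: "\<alpha> * n1 \<le> 3/4 * n1"
    using param_bounds pos by (intro mult_right_mono) auto
  have h: "\<alpha> * (m - 1) < n1" "m - v * (m - 1) \<le> n11"
    using assms(3,4) unfolding m by (auto simp: t l n n1_def algebra_simps)
  have q: "m = n11 + n12 + n2" "n1 = n11 + n12" by (simp_all add: m n1_def)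
  have "n12 \<le> 79/100 * (n12 + n2)" "n2 \<le> 79/100 * (n12 + n2)"
    using h am n1 c an1 m31 q unfolding ring_distribs mult_1_right by linarith+
  then have "alm (79/100) \<langle>t12, a, r\<rangle>" using b by (simp add: almost_def C_bal_def n)
  moreover have "n11 \<le> \<alpha> * (m - 1)" "n12 + n2 \<le> \<alpha> * (m - 1)"
    using h am n1 c an1 m31 q unfolding ring_distribs mult_1_right by linarith+
  moreover have "alm (79/100) t11" using bal_almost[OF b(1)] param_bounds by simp
  ultimately show ?thesis
    using rot_neq by (simp add: almost_children_def m) (simp add: t l heavy_Node n)
qed

lemma RC_drot:
  assumes "bal t" "31 \<le> wt t []" "\<alpha> * (wt t [] - 1) < wt t [L]"
    "wt t [L, L] < (1 - v) * wt t [] + v"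
  shows "almost_children \<alpha> \<beta> (79/100) (\<alpha> * (wt t [] - 1)) (drot t) \<and> drot t \<noteq> t"
proof -
  obtain l a r where t: "t = \<langle>l, a, r\<rangle>"
    using assms param_bounds by (cases t) auto
  define m where "m = wt t []"
  have m31: "31 \<le> m" using assms m_def by simp
  have am: "7071/10000 * (m - 1) \<le> \<alpha> * (m - 1)" "\<alpha> * m \<le> 3/4 * m"
    "7/10 * (m - 1) \<le> v * (m - 1)" "\<alpha> * (m - 1) \<le> 3/4 * (m - 1)"
    by (rule mult_right_mono; use param_bounds m31 in simp)+
  have "1 < wt l []"
    using assms(3) am m31 by (simp add: t m_def)
  then obtain t11 b t12 where l: "l = \<langle>t11, b, t12\<rangle>"
    using not_Leaf_if_wt_gt_1 by blast
  have h0: "wt t11 [] < m - v * (m - 1)" "\<alpha> * (m - 1) < wt t11 [] + wt t12 []"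
    using assms(3,4) by (simp_all add: m_def t l algebra_simps)
  then have "1 < wt t12 []" using am m31 unfolding ring_distribs mult_1_right by linarith
  then obtain t121 c t122 where t12: "t12 = \<langle>t121, c, t122\<rangle>"
    using not_Leaf_if_wt_gt_1 by blast
  define n11 n121 n122 n2 where n: "n11 = wt t11 []" "n121 = wt t121 []" "n122 = wt t122 []"
    "n2 = wt r []"
  define n12 where n12: "n12 = n121 + n122"
  define n1 where n1_def: "n1 = n11 + n12"
  have m: "m = n1 + n2" "wt t [] = m"
    by (simp_all add: m_def t l t12 n1_def n12 n)
  have pos: "0 < n11" "0 < n121" "0 < n122" "0 < n2" "0 < n1" "0 < n12"
    unfolding n n12 n1_def by (auto intro: wt_pos add_pos_pos)
  have b: "bal t11" "bal t12" "bal r" "bal l" "bal t121" "bal t122"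
    using assms(1) by (auto simp: t l t12)
  have n1: "n1 \<le> \<alpha> * m"
    using bal_C_bal[OF assms(1)] by (auto simp: C_bal_def m) (auto simp: t l t12 n n12 n1_def)
  have c: "n11 \<le> \<alpha> * n1" "n12 \<le> \<alpha> * n1" "n121 \<le> \<alpha> * n12" "n122 \<le> \<alpha> * n12"
    using bal_C_bal[OF b(4)] bal_C_bal[OF b(2)]
    by (auto simp: C_bal_def l t12 n n12 n1_def algebra_simps)
  have an: "\<alpha> * n1 \<le> 3/4 * n1" "\<alpha> * n12 \<le> 3/4 * n12"
    by (rule mult_right_mono; use param_bounds pos in simp)+
  have h: "\<alpha> * (m - 1) < n1" "n11 < m - v * (m - 1)"
    using h0 by (auto simp: t l t12 n n12 n1_def)
  note q = m(1) n12 n1_def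
  have "n11 \<le> 79/100 * (n11 + n121)" "n121 \<le> 79/100 * (n11 + n121)"
    "n122 \<le> 79/100 * (n122 + n2)" "n2 \<le> 79/100 * (n122 + n2)"
    using h am n1 c an m31 q pos unfolding ring_distribs mult_1_right by linarith+
  then have "alm (79/100) \<langle>t11, b, t121\<rangle>" "alm (79/100) \<langle>t122, a, r\<rangle>"
    using b by (auto simp: almost_def C_bal_def n)
  moreover have "n11 + n121 \<le> \<alpha> * (m - 1)"
  proof -
    \<comment> \<open>Losing a part of weight at least \<alpha> turns
      \<open>n1 \<le> \<alpha> * m\<close> into the bound with \<open>m - 1\<close>.\<close>
    have "\<alpha> \<le> n122" using h am n1 c an m31 q pos param_bounds unfolding ring_distribs mult_1_right by linarith
    then show ?thesis using n1 q by (simp add: right_diff_distrib)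
  qed
  moreover have "n122 + n2 \<le> \<alpha> * (m - 1)"
  proof -
    have "\<alpha> * n12 \<le> \<alpha> * (\<alpha> * n1)" using c param_bounds by (intro mult_left_mono) auto
    then have "n122 + n2 \<le> m - (1 - \<alpha> * \<alpha>) * n1" using c q by (simp add: algebra_simps)
    also have "\<dots> \<le> m - (1 - \<alpha> * \<alpha>) * (\<alpha> * (m - 1))"
      using h beta_less alpha_less alpha_greater mult_mono[of \<alpha> "3/4" \<alpha> "3/4"] by (auto intro!: mult_left_mono)
    also have "\<dots> = m + \<alpha> * (m - 1) - \<alpha> * (2 - \<alpha> * \<alpha>) * (m - 1)" by (simp add: algebra_simps)
    \<comment> \<open>The surplus \<open>0.06 * (m - 1)\<close> is at least 1.8 and makes up for the
      difference 1 between \<open>m\<close> and \<open>m - 1\<close>.\<close>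
    also have "\<dots> \<le> m + \<alpha> * (m - 1) - 106/100 * (m - 1)"
      using alpha_cubic m31 by (intro diff_left_mono mult_right_mono) auto
    finally show ?thesis using m31 unfolding ring_distribs mult_1_right by linarith
  qed
  ultimately show ?thesis
    using drot_neq by (simp add: almost_children_def m) (simp add: t l t12 heavy_Node n)
qed

text \<open>The threshold parameter \<open>z\<close> is \<beta> if no child of the root was too
  heavy and \<open>y\<close> after a rotation caused by a heavy child; the bound on the
  grandchildren is stated with \<beta> in both cases.\<close>

lemma RGC_rot:
  assumes "alm \<alpha> t" "31 \<le> wt t []" "heavy t \<le> \<alpha> * (wt t [] - 1)" "B \<le> z" "z \<le> \<beta>"
    "z * wt t [] + R_shift z < wt t [L, L]"
  shows "almost_children \<alpha> \<beta> (79/100) (\<alpha> * (wt t [] - 1)) (rot t) \<and>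
    grand_le (\<beta> * wt t [] + R_shift \<beta>) (rot t) \<and> heavy (rot t) \<le> heavy t \<and> rot t \<noteq> t"
proof -
  obtain l a r where t: "t = \<langle>l, a, r\<rangle>"
    using assms param_bounds by (cases t) auto
  define m where "m = wt t []"
  have m31: "31 \<le> m" using assms m_def by simp
  have am: "7071/10000 * (m - 1) \<le> \<alpha> * (m - 1)" "\<alpha> * m \<le> 3/4 * m"
    "\<alpha> * (m - 1) \<le> 3/4 * (m - 1)" "478/1000 * m \<le> z * m" "478/1000 * m \<le> \<beta> * m"
    by (rule mult_right_mono; use param_bounds m31 assms in simp)+
  note Rz = R_shift_lower(1)[OF assms(4,5)] and Rb = R_shift_lower(1)[OF beta_bounds(1) order.refl]
  have h: "478/1000 * m - 9/16 < wt t [L, L]"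
    using assms(6) am Rz unfolding m_def by linarith
  then have "1 < wt t [L, L]" using m31 by linarith
  then obtain t11 b t12 where l: "l = \<langle>t11, b, t12\<rangle>"
    by (cases l) (auto simp: t)
  define n11 n12 n2 where n: "n11 = wt t11 []" "n12 = wt t12 []" "n2 = wt r []"
  define n1 where "n1 = n11 + n12"
  have m: "m = n1 + n2" "wt t [] = m"
    by (simp_all add: m_def t l n1_def n)
  have pos: "0 < n11" "0 < n12" "0 < n2" "0 < n1"
    unfolding n n1_def by (auto intro: wt_pos add_pos_pos)
  have b: "bal t11" "bal t12" "bal r" "bal l"
    using assms(1) by (auto simp: t l almost_def)
  have n1: "n1 \<le> \<alpha> * (m - 1)"
    using assms(3) by (auto simp: m) (auto simp: t l n n1_def heavy_Node)
  have c: "n11 \<le> \<alpha> * n1" "n12 \<le> \<alpha> * n1"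
    using bal_C_bal[OF b(4)] by (auto simp: C_bal_def l n n1_def)
  have g: "wt t11 [L] \<le> \<beta> * n1" "wt t11 [R] \<le> \<beta> * n1"
    using bal_GC_bal[OF b(4)] by (auto simp: GC_bal_def l n n1_def)
  have an1: "\<alpha> * n1 \<le> 3/4 * n1" "\<beta> * n1 \<le> 9/16 * n1"
    using param_bounds pos by (auto intro: mult_right_mono)
  have h: "478/1000 * m - 9/16 < n11"
    using h by (simp add: t l n)
  have q: "m = n11 + n12 + n2" "n1 = n11 + n12" by (simp_all add: m n1_def)
  have "n12 \<le> 79/100 * (n12 + n2)" "n2 \<le> 79/100 * (n12 + n2)"
    using h am n1 c an1 m31 q unfolding ring_distribs mult_1_right by linarith+
  then have "alm (79/100) \<langle>t12, a, r\<rangle>" using b by (simp add: almost_def C_bal_def n)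
  moreover have "n11 \<le> \<alpha> * (m - 1)" "n12 + n2 \<le> \<alpha> * (m - 1)" "n11 \<le> n1" "n12 + n2 \<le> n1"
    using h am n1 c an1 m31 q pos unfolding ring_distribs mult_1_right by linarith+
  moreover have "alm (79/100) t11" using bal_almost[OF b(1)] param_bounds by simp
  moreover have "wt t11 [L] \<le> \<beta> * m + R_shift \<beta>" "wt t11 [R] \<le> \<beta> * m + R_shift \<beta>"
      "n12 \<le> \<beta> * m + R_shift \<beta>" "n2 \<le> \<beta> * m + R_shift \<beta>"
    using h am n1 c an1 m31 q pos g Rb unfolding ring_distribs mult_1_right by linarith+
  ultimately show ?thesis
    using rot_neq by (simp add: almost_children_def grand_le_def m) (simp add: t l heavy_Node n n1_def)
qed

text \<open>The weights are integers, so \<open>n\<^sub>1\<^sub>2\<^sub>2 + n\<^sub>2 < n\<^sub>1 + 1\<close> is as good as \<open>n\<^sub>1\<^sub>2\<^sub>2 + n\<^sub>2 \<le> n\<^sub>1\<close>.\<close>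

lemma beta_heavy_parent:
  assumes "31 \<le> m" "\<beta> * m + R_shift \<beta> < \<alpha> * n1"
  shows "m - (2 - \<beta>) * n1 < 1"
proof -
  define e where "e = \<beta> * (2 - \<beta>) - \<alpha>"
  have "(2 - \<beta>) * (\<beta> * m + R_shift \<beta>) < (2 - \<beta>) * (\<alpha> * n1)"
    using assms param_bounds by (intro mult_strict_left_mono) auto
  moreover have "\<alpha> * (m - 1) \<le> (2 - \<beta>) * (\<beta> * m + R_shift \<beta>)"
  proof (cases "1 / 2 \<le> \<beta>")
    case True
    then have R: "R_shift \<beta> = - \<beta>" by (simp add: R_shift_def)
    \<comment> \<open>The product equals \<open>4 * \<beta> * (2 - \<beta>) - 3\<close>, so
      \<open>\<beta> * (2 - \<beta>) \<ge> 3/4 > \<alpha>\<close>.\<close>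
    have "0 \<le> (2 * \<beta> - 1) * (3 - 2 * \<beta>)" using True param_bounds by (intro mult_nonneg_nonneg) auto
    then have "0 \<le> e" using param_bounds by (simp add: e_def algebra_simps)
    then have "0 \<le> e * (m - 1)" using assms by simp
    then show ?thesis unfolding R e_def by (simp add: algebra_simps)
  next
    case False
    then have R: "R_shift \<beta> = \<beta> - 1" by (simp add: R_shift_def)
    have "B * B \<le> \<beta> * \<beta>" using param_bounds by (intro mult_mono) auto
    then have "\<alpha> \<le> \<beta> + \<beta> * \<beta>" using alpha_B param_bounds by simp
    then have "\<beta> * (1 - 2 * \<beta>) \<le> e" by (simp add: e_def algebra_simps)
    then have "\<beta> * (1 - 2 * \<beta>) * (m - 1) \<le> e * (m - 1)"
      using assms by (intro mult_right_mono) auto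
    \<comment> \<open>The loss through the shift and the lower bound on \<open>e\<close> share the
      factor \<open>1 - 2 * \<beta>\<close>, so it is enough that \<open>\<beta> * (m - 1)\<close>
      exceeds \<open>2 - \<beta>\<close>.\<close>
    moreover have "(1 - 2 * \<beta>) * (2 - \<beta>) \<le> (1 - 2 * \<beta>) * (\<beta> * (m - 1))"
    proof -
      have "478/1000 * 30 \<le> \<beta> * (m - 1)" using param_bounds assms by (intro mult_mono) auto
      then show ?thesis using param_bounds False by (intro mult_left_mono) auto
    qed
    moreover have "(2 - \<beta>) * (\<beta> * m + R_shift \<beta>) - \<alpha> * (m - 1) = e * (m - 1) - (1 - 2 * \<beta>) * (2 - \<beta>)"
      unfolding R e_def by algebra
    ultimately show ?thesis by (simp add: mult_ac)
  qed
  ultimately have "\<alpha> * (m - 1) < \<alpha> * ((2 - \<beta>) * n1)" by (simp add: mult_ac)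
  then show ?thesis using param_bounds by simp
qed

text \<open>The comparison with \<open>heavy t\<close> is tied to \<open>z = \<beta>\<close>. For
  \<open>z = y\<close> the tree stems from a root whose heavier child had at least
  \<open>\<alpha> * (m - 1)\<close>, and the bound \<open>\<alpha> * (m - 1)\<close> takes
  over.\<close>

lemma RGC_drot:
  assumes "alm \<alpha> t" "31 \<le> wt t []" "heavy t \<le> \<alpha> * (wt t [] - 1)" "B \<le> z" "z \<le> \<beta>"
    "z * wt t [] + R_shift z < wt t [L, R]"
  shows "almost_children \<alpha> \<beta> (79/100) (\<alpha> * (wt t [] - 1)) (drot t) \<and>
    grand_le (\<beta> * wt t [] + R_shift \<beta>) (drot t) \<and> (z = \<beta> \<longrightarrow> heavy (drot t) \<le> heavy t) \<and> drot t \<noteq> t"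
proof -
  obtain l a r where t: "t = \<langle>l, a, r\<rangle>"
    using assms param_bounds by (cases t) auto
  define m where "m = wt t []"
  have m31: "31 \<le> m" using assms m_def by simp
  have am: "7071/10000 * (m - 1) \<le> \<alpha> * (m - 1)" "\<alpha> * m \<le> 3/4 * m"
    "\<alpha> * (m - 1) \<le> 3/4 * (m - 1)" "478/1000 * m \<le> z * m" "478/1000 * m \<le> \<beta> * m" "B * m \<le> z * m"
    by (rule mult_right_mono; use param_bounds m31 assms in simp)+
  note Rz = R_shift_lower[OF assms(4,5)] and Rb = R_shift_lower(1)[OF beta_bounds(1) order.refl]
  have h': "z * m + R_shift z < wt t [L, R]" using assms(6) by (simp add: m_def)
  then have h: "478/1000 * m - 9/16 < wt t [L, R]"
    using am Rz by linarith
  then have "1 < wt t [L, R]" using m31 by linarith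
  then obtain t11 b t12 where l: "l = \<langle>t11, b, t12\<rangle>" and "1 < wt t12 []"
    by (cases l) (auto simp: t)
  then obtain t121 c t122 where t12: "t12 = \<langle>t121, c, t122\<rangle>"
    using not_Leaf_if_wt_gt_1 by blast
  define n11 n121 n122 n2 where n: "n11 = wt t11 []" "n121 = wt t121 []" "n122 = wt t122 []"
    "n2 = wt r []"
  define n12 where n12: "n12 = n121 + n122"
  define n1 where n1_def: "n1 = n11 + n12"
  have m: "m = n1 + n2" "wt t [] = m"
    by (simp_all add: m_def t l t12 n1_def n12 n)
  have pos: "0 < n11" "0 < n121" "0 < n122" "0 < n2" "0 < n1" "0 < n12"
    unfolding n n12 n1_def by (auto intro: wt_pos add_pos_pos)
  have b: "bal t11" "bal t12" "bal r" "bal l" "bal t121" "bal t122"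
    using assms(1) by (auto simp: t l t12 almost_def)
  have n1: "n1 \<le> \<alpha> * (m - 1)"
    using assms(3) by (auto simp: m) (auto simp: t l t12 n n12 n1_def heavy_Node)
  have c: "n11 \<le> \<alpha> * n1" "n12 \<le> \<alpha> * n1" "n121 \<le> \<alpha> * n12" "n122 \<le> \<alpha> * n12"
    using bal_C_bal[OF b(4)] bal_C_bal[OF b(2)]
    by (auto simp: C_bal_def l t12 n n12 n1_def algebra_simps)
  have g: "n121 \<le> \<beta> * n1" "n122 \<le> \<beta> * n1"
    using bal_GC_bal[OF b(4)] by (auto simp: GC_bal_def l t12 n n12 n1_def algebra_simps)
  have an: "\<alpha> * n1 \<le> 3/4 * n1" "\<alpha> * n12 \<le> 3/4 * n12" "\<beta> * n1 \<le> 9/16 * n1"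
    by (rule mult_right_mono; use param_bounds pos in simp)+
  have h: "478/1000 * m - 9/16 < n12" and h': "z * m + R_shift z < n12"
    using h h' by (simp_all add: t l t12 n n12)
  note q = m(1) n12 n1_def
  have "n11 \<le> 79/100 * (n11 + n121)" "n121 \<le> 79/100 * (n11 + n121)"
    "n122 \<le> 79/100 * (n122 + n2)" "n2 \<le> 79/100 * (n122 + n2)"
    using h am n1 c an m31 q pos unfolding ring_distribs mult_1_right by linarith+
  then have "alm (79/100) \<langle>t11, b, t121\<rangle>" "alm (79/100) \<langle>t122, a, r\<rangle>"
    using b by (auto simp: almost_def C_bal_def n)
  moreover have m1: "n11 + n121 \<le> n1" using pos q by simp
  moreover have "n11 + n121 \<le> \<alpha> * (m - 1)" using m1 n1 by simp
  moreover have "n122 + n2 \<le> \<alpha> * (m - 1)"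
  proof -
    \<comment> \<open>\<open>\<alpha> = B * (1 + B)\<close> with \<open>1 + B \<le> 3/2\<close>;
      hence a grandchild above the threshold forces \<open>n1\<close> to nearly two thirds of
      \<open>m\<close>.\<close>
    have "\<alpha> * (2/3) \<le> B"
      using mult_left_mono[of B "1/2" B] B_bounds by (simp add: alpha_B algebra_simps)
    then have "\<alpha> * (2/3) * m \<le> B * m" using m31 by (intro mult_right_mono) auto
    then have "\<alpha> * (2/3 * m - 3/4) \<le> \<alpha> * n1"
      using am Rz c h' by (simp add: algebra_simps)
    then have n1': "2/3 * m - 3/4 \<le> n1" using param_bounds by simp
    have "\<alpha> * n12 \<le> \<alpha> * (\<alpha> * n1)" using c param_bounds by (intro mult_left_mono) auto
    then have "n122 + n2 \<le> m - (1 - \<alpha> * \<alpha>) * n1" using c q by (simp add: algebra_simps)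
    also have "\<dots> \<le> m - (1 - \<alpha> * \<alpha>) * (2/3 * m - 3/4)"
      using n1' alpha_less alpha_greater mult_mono[of \<alpha> "3/4" \<alpha> "3/4"] by (auto intro!: mult_left_mono)
    also have "\<dots> = \<alpha> * (m - 1) - (2/3) * ((\<alpha> - 1/2) * (1 - \<alpha>)) * m + (\<alpha> + 3/4 - 3/4 * (\<alpha> * \<alpha>))"
      by (simp add: field_simps)
    also have "\<dots> \<le> \<alpha> * (m - 1) - (2/3) * (6/100) * 31 + (\<alpha> + 3/4 - 3/8)"
    proof -
      \<comment> \<open>This product is \<open>(\<alpha> - 1/2) * (1 - \<alpha>) - 6/100\<close>. At
        weight 31 the resulting gain 1.24 exceeds the constant term, which is below 1.125.\<close>
      have "0 \<le> (\<alpha> - 7/10) * (8/10 - \<alpha>)" using param_bounds by (intro mult_nonneg_nonneg) auto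
      then have "6/100 \<le> (\<alpha> - 1/2) * (1 - \<alpha>)" by (simp add: field_simps)
      then have "(2/3) * (6/100) * 31 \<le> (2/3) * ((\<alpha> - 1/2) * (1 - \<alpha>)) * m"
        using m31 by (intro mult_mono) auto
      then show ?thesis using alpha_sq by linarith
    qed
    finally show ?thesis using param_bounds by simp
  qed
  moreover have "heavy (drot t) \<le> heavy t" if "z = \<beta>"
  proof -
    have "m - (2 - \<beta>) * n1 < 1"
      using that h' c m31 by (intro beta_heavy_parent) auto
    then have "n122 + n2 < n1 + 1" using g q by (simp add: algebra_simps)
    then have "real (size1 t122 + size1 r) < real (size1 t11 + (size1 t121 + size1 t122) + 1)"
      by (simp add: n1_def n12 n wt_Nil)
    then have "size1 t122 + size1 r \<le> size1 t11 + (size1 t121 + size1 t122)"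
      unfolding of_nat_less_iff by simp
    then have "n122 + n2 \<le> n1"
      unfolding n1_def n12 n wt_Nil of_nat_add[symmetric] of_nat_le_iff .
    then show ?thesis using m1 by (simp add: t l t12 heavy_Node n n12 n1_def add.assoc)
  qed
  moreover have "n11 \<le> \<beta> * m + R_shift \<beta>" "n121 \<le> \<beta> * m + R_shift \<beta>"
    "n122 \<le> \<beta> * m + R_shift \<beta>" "n2 \<le> \<beta> * m + R_shift \<beta>"
    using h am n1 c an m31 q pos g Rb unfolding ring_distribs mult_1_right by linarith+
  ultimately show ?thesis
    using drot_neq by (simp add: almost_children_def grand_le_def m)
      (simp add: t l t12 heavy_Node n n12 n1_def add.assoc)
qed

end

section \<open>Top-down balancing\<close>

lemma inorder_rot [simp]: "inorder (rot t) = inorder t"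
  by (cases t rule: rot.cases) simp_all

lemma inorder_drot [simp]: "inorder (drot t) = inorder t"
  by (cases t rule: drot.cases) simp_all

lemma inorder_rot_mirror [simp]: "inorder (rot_mirror t) = inorder t"
  by (cases t rule: rot_mirror.cases) simp_all

lemma inorder_drot_mirror [simp]: "inorder (drot_mirror t) = inorder t"
  by (cases t rule: drot_mirror.cases) simp_all

lemma inorder_on_children: "(\<And>s. inorder (f s) = inorder s) \<Longrightarrow> inorder (on_children f t) = inorder t"
  by (cases t) simp_all

lemma inorder_C_balance [simp]: "inorder (C_balance u v w x t) = inorder t"
  by (simp add: C_balance_def)

lemma inorder_GC_balance [simp]: "inorder (GC_balance y z t) = inorder t"
  by (simp add: GC_balance_def)

lemma inorder_CGC_balance [simp]: "inorder (CGC_balance u v y y' t) = inorder t"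
  by (simp add: CGC_balance_def Let_def inorder_on_children)

lemma inorder_RCGC_balance [simp]: "inorder (RCGC_balance u v y y' t) = inorder t"
  by (simp add: RCGC_balance_def Let_def inorder_on_children)

text \<open>In this form the bound is preserved when the children are CGC-balanced, since that does
  not increase \<open>heavy\<close>.\<close>

lemma grand_le_Node: "grand_le g \<langle>l, a, r\<rangle> \<longleftrightarrow> heavy l \<le> g \<and> heavy r \<le> g"
  by (auto simp: grand_le_def heavy_def)

lemma C_bal_iff_heavy: "C_bal x t \<longleftrightarrow> heavy t \<le> x * wt t []"
  by (auto simp: C_bal_def heavy_def)

lemma GC_bal_iff_grand_le: "GC_bal y t \<longleftrightarrow> grand_le (y * wt t []) t"
  by (auto simp: GC_bal_def grand_le_def)

lemma half_le_heavy: "wt t [] \<le> 2 * heavy t"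
  using wt_split[of t] by (simp add: heavy_def)

context gcb_params begin

lemma RC_balance_cases:
  assumes "bal t" "31 \<le> wt t []"
  defines "s \<equiv> C_balance \<alpha> v (R_shift \<alpha>) (R_shift v) t"
  shows "s = t \<and> heavy t \<le> \<alpha> * (wt t [] - 1) \<or>
    s \<noteq> t \<and> almost_children \<alpha> \<beta> (79/100) (\<alpha> * (wt t [] - 1)) s \<and> \<alpha> * (wt t [] - 1) \<le> heavy t"
proof (cases rule: C_balance_cases[of \<alpha> v "R_shift \<alpha>" "R_shift v" t])
  case none
  then show ?thesis unfolding s_def by (simp add: heavy_def R_shift_large algebra_simps)
next
  case rot
  then show ?thesis unfolding s_def using RC_rot[of t] assms
    by (simp add: heavy_def R_shift_large algebra_simps)
next
  case drot
  then show ?thesis unfolding s_def using RC_drot[of t] assms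
    by (simp add: heavy_def R_shift_large algebra_simps)
next
  case rot_mirror
  have "rot_mirror t \<noteq> t" if "rot (mirror t) \<noteq> mirror t"
    using that by (metis rot_mirror_eq mirror_mirror)
  then show ?thesis unfolding s_def using rot_mirror RC_rot[of "mirror t"] assms
    by (simp add: heavy_def R_shift_large algebra_simps rot_mirror_eq wt_mirror)
next
  case drot_mirror
  have "drot_mirror t \<noteq> t" if "drot (mirror t) \<noteq> mirror t"
    using that by (metis drot_mirror_eq mirror_mirror)
  then show ?thesis unfolding s_def using drot_mirror RC_drot[of "mirror t"] assms
    by (simp add: heavy_def R_shift_large algebra_simps drot_mirror_eq wt_mirror)
qed

text \<open>\<open>R_shift\<close> falls by at most \<open>z' - z\<close>, while
  \<open>z * m\<close> grows by at least as much because \<open>m \<ge> 1\<close>.\<close>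

lemma R_threshold_mono:
  assumes "1 \<le> m" "z \<le> z'"
  shows "z * m + R_shift z \<le> z' * m + R_shift z'"
proof -
  have "0 \<le> (z' - z) * (m - 1)" using assms by simp
  then show ?thesis using assms by (auto simp: R_shift_def min_def algebra_simps)
qed

lemma RGC_balance_cases:
  assumes "alm \<alpha> t" "31 \<le> wt t []" "heavy t \<le> \<alpha> * (wt t [] - 1)" "B \<le> z" "z \<le> \<beta>"
  defines "s \<equiv> GC_balance z (R_shift z) t"
  shows "grand_le (\<beta> * wt t [] + R_shift \<beta>) s \<and> (z = \<beta> \<longrightarrow> heavy s \<le> heavy t) \<and>
    (s = t \<or> s \<noteq> t \<and> almost_children \<alpha> \<beta> (79/100) (\<alpha> * (wt t [] - 1)) s)"
proof (cases rule: GC_balance_cases[of z "R_shift z" t])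
  case none
  then have "grand_le (z * wt t [] + R_shift z) t" by (simp add: grand_le_def)
  then have "grand_le (\<beta> * wt t [] + R_shift \<beta>) t"
    using R_threshold_mono[of "wt t []" z \<beta>] assms wt_Nil_ge_1[of t] by (auto simp: grand_le_def)
  then show ?thesis using none by (auto simp: s_def)
next
  case rot_mirror
  have "rot_mirror t \<noteq> t" if "rot (mirror t) \<noteq> mirror t"
    using that by (metis rot_mirror_eq mirror_mirror)
  then show ?thesis unfolding s_def using rot_mirror RGC_rot[of "mirror t"] assms
    by (auto simp: rot_mirror_eq wt_mirror)
next
  case drot_mirror
  have "drot_mirror t \<noteq> t" if "drot (mirror t) \<noteq> mirror t"
    using that by (metis drot_mirror_eq mirror_mirror)
  then show ?thesis unfolding s_def using drot_mirror RGC_drot[of "mirror t"] assms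
    by (auto simp: drot_mirror_eq wt_mirror)
qed (use RGC_rot[of t] RGC_drot[of t] assms in auto)

lemma on_children_CGC:
  assumes "almost_children \<alpha> \<beta> (79/100) m t"
  obtains l a r where "on_children (CGC_balance v v y y) t = \<langle>l, a, r\<rangle>" "bal l" "bal r"
    "heavy \<langle>l, a, r\<rangle> = heavy t" "heavy \<langle>l, a, r\<rangle> \<le> m" "wt \<langle>l, a, r\<rangle> [] = wt t []"
    "\<And>g. grand_le g t \<Longrightarrow> grand_le g \<langle>l, a, r\<rangle>"
proof -
  obtain l a r where t: "t = \<langle>l, a, r\<rangle>" "alm (79/100) l" "alm (79/100) r" "heavy t \<le> m"
    using assms by (auto simp: almost_children_def)
  show thesis
    by (rule that[of "CGC_balance v v y y l" a "CGC_balance v v y y r"])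
      (use t CGC_balance_balanced[of l] CGC_balance_balanced[of r] in
        \<open>auto simp: heavy_def[of "Node _ _ _"] grand_le_Node\<close>)
qed

lemma almost_children_if_bal:
  assumes "t = \<langle>l, a, r\<rangle>" "bal l" "bal r" "heavy t \<le> m"
  shows "almost_children \<alpha> \<beta> (79/100) m t"
  using assms bal_almost[of l "79/100"] bal_almost[of r "79/100"] param_bounds by (simp add: almost_children_def)

text \<open>The last claim has two sources: without a heavy child, GC-balancing with threshold
  \<beta> does not increase \<open>heavy\<close>; otherwise
  \<open>\<alpha> * (wt t [] - 1) \<le> heavy t\<close>, so the first bound implies it.\<close>

lemma RCGC_balance_robust:
  assumes "bal t" "31 \<le> wt t []"
  obtains l a r where "RCGC_balance \<alpha> v \<beta> y t = \<langle>l, a, r\<rangle>" "bal l" "bal r"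
    "heavy \<langle>l, a, r\<rangle> \<le> \<alpha> * (wt t [] - 1)" "grand_le (\<beta> * wt t [] + R_shift \<beta>) \<langle>l, a, r\<rangle>"
    "heavy \<langle>l, a, r\<rangle> \<le> heavy t"
proof -
  define t1 where "t1 = C_balance \<alpha> v (R_shift \<alpha>) (R_shift v) t"
  have le: "\<alpha> * (wt t [] - 1) \<le> \<alpha> * wt t []"
    using param_bounds by simp
  consider "t1 = t" "heavy t \<le> \<alpha> * (wt t [] - 1)"
    | "t1 \<noteq> t" "almost_children \<alpha> \<beta> (79/100) (\<alpha> * (wt t [] - 1)) t1" "\<alpha> * (wt t [] - 1) \<le> heavy t"
    using RC_balance_cases[OF assms] unfolding t1_def by blast
  then show thesis
  proof cases
    case 1
    define t2 where "t2 = GC_balance \<beta> (R_shift \<beta>) t"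
    have t2: "grand_le (\<beta> * wt t [] + R_shift \<beta>) t2" "heavy t2 \<le> heavy t"
      "t2 = t \<or> t2 \<noteq> t \<and> almost_children \<alpha> \<beta> (79/100) (\<alpha> * (wt t [] - 1)) t2"
      using RGC_balance_cases[OF bal_almost[OF assms(1) order.refl] assms(2) 1(2) beta_bounds(1) order.refl]
      unfolding t2_def by auto
    show thesis
    proof (cases "t2 = t")
      case True
      obtain l a r where t: "t = \<langle>l, a, r\<rangle>" using assms by (cases t) auto
      have "RCGC_balance \<alpha> v \<beta> y t = t"
        using 1 True by (simp add: RCGC_balance_def Let_def flip: t1_def t2_def)
      then show ?thesis
        by (intro that[of l a r]) (use assms 1 t2 True in \<open>auto simp: t\<close>)
    next
      case False
      have eq: "RCGC_balance \<alpha> v \<beta> y t = on_children (CGC_balance v v y y) t2"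
        using 1 False by (simp add: RCGC_balance_def Let_def flip: t1_def t2_def)
      from False t2(3) have "almost_children \<alpha> \<beta> (79/100) (\<alpha> * (wt t [] - 1)) t2" by simp
      then show ?thesis
        by (rule on_children_CGC) (use t2 eq in \<open>auto intro!: that\<close>)
    qed
  next
    case 2
    obtain l a r where t2: "on_children (CGC_balance v v y y) t1 = \<langle>l, a, r\<rangle>" "bal l" "bal r"
      "heavy \<langle>l, a, r\<rangle> \<le> \<alpha> * (wt t [] - 1)" "wt \<langle>l, a, r\<rangle> [] = wt t1 []"
      using on_children_CGC[OF 2(2)] by metis
    define t2 where "t2 = \<langle>l, a, r\<rangle>"
    have m: "wt t2 [] = wt t []" using t2 by (simp add: t1_def wt_Nil size1_size t2_def)
    have "alm \<alpha> t2" using t2 le m by (simp add: almost_def C_bal_iff_heavy t2_def)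
    moreover define t3 where "t3 = GC_balance y (R_shift y) t2"
    ultimately have t3: "grand_le (\<beta> * wt t [] + R_shift \<beta>) t3"
      "t3 = t2 \<or> almost_children \<alpha> \<beta> (79/100) (\<alpha> * (wt t [] - 1)) t3"
      using RGC_balance_cases[of t2 y] assms(2) t2 m y_bounds by (auto simp: t2_def)
    \<comment> \<open>Even if GC-balancing left \<open>t2\<close> alone, the final CGC pass still
      runs, so its balanced children are weakened to the form that this pass accepts.\<close>
    have "almost_children \<alpha> \<beta> (79/100) (\<alpha> * (wt t [] - 1)) t3"
      using t3(2) almost_children_if_bal[OF t2_def] t2 by (auto simp: t2_def)
    moreover have "RCGC_balance \<alpha> v \<beta> y t = on_children (CGC_balance v v y y) t3"
      using 2 t2(1) by (simp add: RCGC_balance_def Let_def t3_def t2_def flip: t1_def)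
    ultimately show thesis
      by (elim on_children_CGC) (use t3 2 in \<open>auto intro!: that\<close>)
  qed
qed

end

section \<open>Keys and weights after an update\<close>

fun update_set :: "'a update \<Rightarrow> 'a set \<Rightarrow> 'a set" where
  "update_set (Insert k) S = insert k S"
| "update_set (Delete k) S = S - {k}"

lemma hd_inorder_least:
  assumes "bst t" "t \<noteq> \<langle>\<rangle>"
  shows "hd (inorder t) \<in> set_tree t" "x \<in> set_tree t \<Longrightarrow> hd (inorder t) \<le> x"
proof -
  have "inorder t \<noteq> []" using assms by (cases t) auto
  moreover have "sorted_wrt (<) (inorder t)" using assms by (simp add: bst_iff_sorted_wrt_less)
  ultimately show "hd (inorder t) \<in> set_tree t" "x \<in> set_tree t \<Longrightarrow> hd (inorder t) \<le> x"
    unfolding set_inorder[symmetric] by (cases "inorder t"; auto)+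
qed

lemma bst_insert_correct: "bst t \<Longrightarrow> bst (bst_insert k t) \<and> set_tree (bst_insert k t) = insert k (set_tree t)"
  by (induction t) auto

lemma bst_delete_correct: "bst t \<Longrightarrow> bst (bst_delete k t) \<and> set_tree (bst_delete k t) = set_tree t - {k}"
proof (induction t arbitrary: k)
  case (Node l a r)
  note D = hd_inorder_least[of r]
  consider "k < a" | "a < k" | "k = a" "l = \<langle>\<rangle>" | "k = a" "r = \<langle>\<rangle>" | "k = a" "l \<noteq> \<langle>\<rangle>" "r \<noteq> \<langle>\<rangle>"
    by force
  then show ?case
  proof cases
    case 5
    define m where "m = hd (inorder r)"
    have r: "bst r" "\<forall>x \<in> set_tree l. x < a" "\<forall>x \<in> set_tree r. a < x" using Node.prems by auto
    have m: "m \<in> set_tree r" "\<forall>x \<in> set_tree r. m \<le> x"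
      unfolding m_def using D(1)[OF r(1) 5(3)] D(2)[OF r(1) 5(3)] by blast+
    have eq: "bst_delete k \<langle>l, a, r\<rangle> = \<langle>l, m, bst_delete m r\<rangle>"
      using 5 by (simp add: m_def Let_def)
    have d: "bst (bst_delete m r)" "set_tree (bst_delete m r) = set_tree r - {m}"
      using Node.IH(2)[OF r(1)] by auto
    have "a < m" "a \<notin> set_tree l" "a \<notin> set_tree r" using m r by blast+
    have lm: "\<forall>x \<in> set_tree l. x < m" using r \<open>a < m\<close> by (meson less_trans)
    have rm: "\<forall>x \<in> set_tree r - {m}. m < x" using m(2) by (auto simp: less_le)
    have "bst \<langle>l, m, bst_delete m r\<rangle>" using lm rm d Node.prems by simp
    moreover have "set_tree \<langle>l, m, bst_delete m r\<rangle> = set_tree \<langle>l, a, r\<rangle> - {k}"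
      using d(2) m(1) 5(1) \<open>a < m\<close> \<open>a \<notin> set_tree l\<close> \<open>a \<notin> set_tree r\<close> by auto
    ultimately show ?thesis unfolding eq by blast
  next
    case 1
    then show ?thesis using Node.IH(1)[of k] Node.prems by auto
  next
    case 2
    then show ?thesis using Node.IH(2)[of k] Node.prems by auto
  qed (use Node.prems in auto)
qed simp

lemma bst_update_correct: "bst t \<Longrightarrow> bst (bst_update upd t) \<and> set_tree (bst_update upd t) = update_set upd (set_tree t)"
  by (cases upd) (simp_all add: bst_insert_correct bst_delete_correct)

lemma bst_size_card: "bst t \<Longrightarrow> size t = card (set_tree t)"
  using distinct_card[of "inorder t"] by (simp add: bst_iff_sorted_wrt_less strict_sorted_iff)

text \<open>A search tree has as many nodes as keys, so the change of weight can be read off the key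
  sets; \<open>d = 0\<close> is the redundant case.\<close>

lemma size_update:
  assumes "bst t" "bst t'" "set_tree t' = update_set upd (set_tree t)"
  shows "\<exists>d \<in> {-1, 0, 1::real}. wt t' [] = wt t [] + d"
proof -
  have "size t' = size t \<or> size t' = size t + 1 \<or> size t = size t' + 1"
  proof (cases upd)
    case (Insert k)
    then show ?thesis
      using bst_size_card[OF assms(1)] bst_size_card[OF assms(2)] assms(3) by (simp add: card_insert_if)
  next
    case (Delete k)
    have "k \<in> set_tree t \<Longrightarrow> card (set_tree t) = Suc (card (set_tree t - {k}))"
      by (rule card.remove) simp_all
    then show ?thesis using Delete
      using bst_size_card[OF assms(1)] bst_size_card[OF assms(2)] assms(3)
      by (cases "k \<in> set_tree t") simp_all
  qed
  then show ?thesis by (auto simp: wt_Nil size1_size)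
qed

lemma bst_inorder: "inorder t = inorder t' \<Longrightarrow> bst t = bst t' \<and> set_tree t = set_tree t'"
  by (simp add: bst_iff_sorted_wrt_less flip: set_inorder)

section \<open>Perfectly balanced trees\<close>

lemma wbalanced_heavy:
  assumes "wbalanced t"
  shows "2 * heavy t \<le> wt t [] + 1" "wt t [] \<le> 2 \<Longrightarrow> 2 * heavy t \<le> wt t []"
proof -
  \<comment> \<open>At weight at most 2 no rounding occurs. This sharper clause serves parents of
    weight 2 or 3, where the general bound on the grandchildren exceeds
    \<open>0.478 * m\<close>.\<close>
  have "\<not> size r = size l + 1" "\<not> size l = size r + 1"
    if "t = \<langle>l, a, r\<rangle>" "wt t [] \<le> 2" for l a r
    using that by (auto simp: wt_Nil size1_size)
  then show "2 * heavy t \<le> wt t []" if "wt t [] \<le> 2"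
    using assms that by (cases t) (auto simp: heavy_def wt_Nil size1_size)
  show "2 * heavy t \<le> wt t [] + 1"
  proof (cases t)
    case (Node l a r)
    then have "real (size l) \<le> real (size r) + 1" "real (size r) \<le> real (size l) + 1"
      using assms by auto
    then show ?thesis by (simp add: Node heavy_def wt_Nil size1_size max_def)
  qed (simp add: heavy_def)
qed

context gcb_params begin

lemma wbalanced_bal: "wbalanced t \<Longrightarrow> bal t"
proof (induction t)
  case (Node l a r)
  define m where "m = size1 l + size1 r"
  have m: "wt \<langle>l, a, r\<rangle> [] = real m" by (simp add: wt_Nil m_def)
  have pos: "1 \<le> size1 l" "1 \<le> size1 r" by (simp_all add: size1_size)
  have am: "7071/10000 * real m \<le> \<alpha> * real m" "478/1000 * real m \<le> \<beta> * real m"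
    by (rule mult_right_mono; use param_bounds in simp)+
  have d: "2 * size1 l \<le> m + 1" "2 * size1 r \<le> m + 1"
    using Node.prems by (auto simp: m_def size1_size)
  have h: "2 * real (size1 l) \<le> real m + 1" "2 * real (size1 r) \<le> real m + 1"
    using d by linarith+
  have m2: "2 \<le> m" using pos m_def by simp
  have w: "2 * heavy l \<le> real (size1 l) + 1" "size1 l \<le> 2 \<Longrightarrow> 2 * heavy l \<le> real (size1 l)"
    "2 * heavy r \<le> real (size1 r) + 1" "size1 r \<le> 2 \<Longrightarrow> 2 * heavy r \<le> real (size1 r)"
    using wbalanced_heavy[of l] wbalanced_heavy[of r] Node.prems by (auto simp: wt_Nil)
  have "real (size1 l) \<le> 7071/10000 * real m \<and> real (size1 r) \<le> 7071/10000 * real m \<and>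
    heavy l \<le> 478/1000 * real m \<and> heavy r \<le> 478/1000 * real m"
  proof (cases "m \<le> 3")
    case True
    then have "size1 l \<le> 2" "size1 r \<le> 2" "m = 2 \<Longrightarrow> size1 l = 1 \<and> size1 r = 1" "m = 2 \<or> m = 3"
      using d m2 pos m_def by linarith+
    then show ?thesis using w by fastforce
  next
    case False
    \<comment> \<open>Rounding twice gives \<open>heavy l \<le> (m + 3) / 4\<close>, which is below
      \<open>0.478 * m\<close> from \<open>m = 4\<close> on.\<close>
    then have "4 \<le> real m" by simp
    then show ?thesis using h w by auto
  qed
  then show ?case
    using Node am unfolding balanced.simps C_bal_iff_heavy GC_bal_iff_grand_le m
    by (auto simp: heavy_Node grand_le_Node wt_Nil)
qed simp

text \<open>For \<open>d\<close> = 1 or -1 the rounding loss is covered by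
  \<open>2 * heavy t' \<le> wt t [] + d + 1\<close>. For \<open>d = 0\<close> one half would be
  lost, so the integer sizes are compared directly.\<close>

lemma wbalanced_heavy_update:
  assumes "wbalanced t'" "d \<in> {-1, 0, 1}" "wt t' [] = wt t [] + d"
  shows "heavy t' \<le> heavy t + max 0 d"
proof (cases "d = 0")
  case True
  then have s: "size t' = size t" using assms by (simp add: wt_Nil size1_size)
  show ?thesis
  proof (cases t')
    case Leaf
    then show ?thesis using s True by (cases t) (auto simp: heavy_def)
  next
    case (Node l' a' r')
    then obtain l a r where t: "t = \<langle>l, a, r\<rangle>" using s by (cases t) auto
    have "max (size1 l') (size1 r') \<le> max (size1 l) (size1 r)"
      using assms(1) s by (auto simp: Node t size1_size)
    then show ?thesis using True by (simp add: Node t heavy_Node wt_Nil flip: of_nat_max)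
  qed
next
  case False
  then show ?thesis
    using wbalanced_heavy(1)[OF assms(1)] assms half_le_heavy[of t] by auto
qed

definition updated :: "'a::linorder update \<Rightarrow> 'a tree \<Rightarrow> 'a tree \<Rightarrow> bool" where
  "updated upd t t' \<longleftrightarrow> bst t' \<and> bal t' \<and> set_tree t' = update_set upd (set_tree t) \<and>
    (\<exists>d \<in> {-1, 0, 1}. wt t' [] = wt t [] + d \<and> heavy t' \<le> heavy t + max 0 d)"

text \<open>This explains \<open>R_shift\<close>: the term \<open>- \<beta>\<close> keeps an
  unchanged grandchild light enough in a tree of weight \<open>m - 1\<close>, the term
  \<open>\<beta> - 1\<close> one that gains 1 in a tree of weight \<open>m + 1\<close>. For \<alpha>
  the first term suffices because \<alpha> > 1/2.\<close>

lemma robust_update: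
  assumes "bal l" "bal r" "heavy \<langle>l, a, r\<rangle> \<le> \<alpha> * (m - 1)" "m = wt l [] + wt r []"
    "grand_le (\<beta> * m + R_shift \<beta>) \<langle>l, a, r\<rangle>"
    "d \<in> {-1, 0, 1}" "bal l'" "wt l' [] = wt l [] + d" "heavy l' \<le> heavy l + max 0 d"
  shows "bal \<langle>l', a', r\<rangle>" "wt \<langle>l', a', r\<rangle> [] = m + d"
    "heavy \<langle>l', a', r\<rangle> \<le> heavy \<langle>l, a, r\<rangle> + max 0 d"
proof -
  show w: "wt \<langle>l', a', r\<rangle> [] = m + d" using assms by simp
  have "R_shift \<beta> \<le> - \<beta>" "R_shift \<beta> \<le> \<beta> - 1" by (auto simp: R_shift_def)
  then have "wt l' [] \<le> \<alpha> * (m + d)" "wt r [] \<le> \<alpha> * (m + d)"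
    "heavy l' \<le> \<beta> * (m + d)" "heavy r \<le> \<beta> * (m + d)"
    using assms param_bounds by (auto simp: heavy_Node grand_le_Node algebra_simps)
  then show "bal \<langle>l', a', r\<rangle>"
    using assms unfolding balanced.simps C_bal_iff_heavy GC_bal_iff_grand_le w
    by (simp add: heavy_Node grand_le_Node)
  show "heavy \<langle>l', a', r\<rangle> \<le> heavy \<langle>l, a, r\<rangle> + max 0 d"
    using assms by (auto simp: heavy_Node)
qed

text \<open>The induction generalizes over \<open>upd\<close>, because deleting the key of the root
  continues with the deletion of its successor.\<close>

lemma top_down_update_updated:
  assumes "perfect_restructuring f" and hat: "v = alpha_hat \<alpha>" "y = beta_hat \<alpha> \<beta>"
    and "bst t" "bal t"
  shows "updated upd t (top_down_update \<alpha> \<beta> f upd t)"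
  using assms(4,5)
proof (induction "size t" arbitrary: t upd rule: less_induct)
  case less
  show ?case
  proof (cases "size t \<le> 29")
    case True
    define t' where "t' = f (bst_update upd t)"
    have f: "wbalanced t'" "inorder t' = inorder (bst_update upd t)"
      using assms(1) by (auto simp: perfect_restructuring_def t'_def)
    have c: "bst t'" "set_tree t' = update_set upd (set_tree t)"
      using bst_inorder[OF f(2)] bst_update_correct[OF less.prems(1)] by auto
    obtain d where "d \<in> {-1, 0, 1::real}" "wt t' [] = wt t [] + d"
      using size_update[OF less.prems(1) c] by blast
    then have "updated upd t t'"
      using c wbalanced_bal[OF f(1)] wbalanced_heavy_update[OF f(1)] by (auto simp: updated_def)
    then show ?thesis using True by (simp add: top_down_update.simps t'_def)
  next
    case False
    define m where "m = wt t []"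
    have m31: "31 \<le> m" using False by (simp add: m_def wt_Nil size1_size)
    obtain l a r where s: "RCGC_balance \<alpha> v \<beta> y t = \<langle>l, a, r\<rangle>" "bal l" "bal r"
      and h: "heavy \<langle>l, a, r\<rangle> \<le> \<alpha> * (m - 1)" and g: "grand_le (\<beta> * m + R_shift \<beta>) \<langle>l, a, r\<rangle>"
      and ht: "heavy \<langle>l, a, r\<rangle> \<le> heavy t"
      using RCGC_balance_robust[OF less.prems(2)] m31 m_def by metis
    have sz: "size l < size t" "size r < size t" using size_children_RCGC_balance[OF s(1)] by auto
    have m: "m = wt l [] + wt r []"
      using size_RCGC_balance[of \<alpha> v \<beta> y t] unfolding s(1) m_def by (simp add: wt_Nil size1_size)
    have "inorder \<langle>l, a, r\<rangle> = inorder t" using inorder_RCGC_balance[of \<alpha> v \<beta> y t] s(1) by simp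
    from bst_inorder[OF this] less.prems have b: "bst \<langle>l, a, r\<rangle>" "set_tree t = set_tree \<langle>l, a, r\<rangle>" by auto
    have bl: "bst l" "bst r" "\<And>x. x \<in> set_tree l \<Longrightarrow> x < a" "\<And>x. x \<in> set_tree r \<Longrightarrow> a < x"
      using b by auto
    have left: "updated upd t \<langle>l', a, r\<rangle>"
      if k: "key upd < a" and u: "updated upd l l'" for l'
    proof -
      obtain d where d: "d \<in> {-1, 0, 1}" "wt l' [] = wt l [] + d" "heavy l' \<le> heavy l + max 0 d"
        and u': "bal l'" "bst l'" "set_tree l' = update_set upd (set_tree l)"
        using u by (auto simp: updated_def)
      note R = robust_update[OF s(2,3) h m g d(1) u'(1) d(2,3), of a]
      have "bst \<langle>l', a, r\<rangle>" "set_tree \<langle>l', a, r\<rangle> = update_set upd (set_tree t)"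
        using k u' bl b(2) by (cases upd; force)+
      then show ?thesis
        unfolding updated_def using R ht d(1) m_def by (intro conjI bexI[of _ d]) auto
    qed
    have right: "updated upd t \<langle>l, a', r'\<rangle>"
      if u: "updated upd' r r'" and k: "bst \<langle>l, a', r'\<rangle>" "set_tree \<langle>l, a', r'\<rangle> = update_set upd (set_tree t)"
      for a' r' upd'
    proof -
      obtain d where d: "d \<in> {-1, 0, 1}" "wt r' [] = wt r [] + d" "heavy r' \<le> heavy r + max 0 d"
        and u': "bal r'"
        using u by (auto simp: updated_def)
      \<comment> \<open>\<open>robust_update\<close> treats the left child; exchanging the children
        reduces the right one to it, as keys play no part in its conditions.\<close>
      have h': "heavy \<langle>r, a, l\<rangle> \<le> \<alpha> * (m - 1)" "grand_le (\<beta> * m + R_shift \<beta>) \<langle>r, a, l\<rangle>"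
        using h g by (auto simp: heavy_Node grand_le_Node)
      note R = robust_update[OF s(3,2) h'(1) _ h'(2) d(1) u' d(2,3), of a']
      have "bal \<langle>r', a', l\<rangle>" "wt \<langle>r', a', l\<rangle> [] = m + d" "heavy \<langle>r', a', l\<rangle> \<le> heavy \<langle>r, a, l\<rangle> + max 0 d"
        using R m by simp_all
      then have "bal \<langle>l, a', r'\<rangle>" "wt \<langle>l, a', r'\<rangle> [] = m + d" "heavy \<langle>l, a', r'\<rangle> \<le> heavy t + max 0 d"
        using ht balanced_mirror[of \<alpha> \<beta> "\<langle>r', a', l\<rangle>"]
        by (auto simp: heavy_Node C_bal_iff_heavy GC_bal_iff_grand_le grand_le_Node add.commute max.commute)
      then show ?thesis
        unfolding updated_def using k d(1) m_def by (intro conjI bexI[of _ d]) auto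
    qed
    consider "key upd < a" | "a < key upd" | k where "upd = Insert k" "k = a" | k where "upd = Delete k" "k = a"
      by (metis linorder_less_linear update.collapse(1) update.collapse(2) update.exhaust_disc)
    then show ?thesis
    proof cases
      case 1
      then have "top_down_update \<alpha> \<beta> f upd t = \<langle>top_down_update \<alpha> \<beta> f upd l, a, r\<rangle>"
        using False s(1) by (subst top_down_update.simps) (simp flip: hat)
      then show ?thesis using left[OF 1 less.hyps[OF sz(1) bl(1) s(2)]] by simp
    next
      case 2
      then have eq: "top_down_update \<alpha> \<beta> f upd t = \<langle>l, a, top_down_update \<alpha> \<beta> f upd r\<rangle>"
        using False s(1) by (subst top_down_update.simps) (auto simp flip: hat)
      have u: "updated upd r (top_down_update \<alpha> \<beta> f upd r)" by (rule less.hyps[OF sz(2) bl(2) s(3)])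
      then have "bst \<langle>l, a, top_down_update \<alpha> \<beta> f upd r\<rangle>"
        "set_tree \<langle>l, a, top_down_update \<alpha> \<beta> f upd r\<rangle> = update_set upd (set_tree t)"
        using 2 bl b(2) unfolding updated_def by (cases upd; force)+
      then show ?thesis unfolding eq using right[OF u] by simp
    next
      case (3 k)
      then have eq: "top_down_update \<alpha> \<beta> f upd t = \<langle>l, a, r\<rangle>"
        using False s(1) by (subst top_down_update.simps) (auto simp flip: hat)
      \<comment> \<open>A redundant insertion still rebalances the root, which is the case
        \<open>d = 0\<close> with unchanged children.\<close>
      note R = robust_update[OF s(2,3) h m g _ s(2), of 0 a]
      show ?thesis unfolding eq updated_def
        using b R ht 3 m_def by (intro conjI bexI[of _ 0]) auto
    next
      case (4 k)
      define k' where "k' = hd (inorder r)"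
      define r' where "r' = top_down_update \<alpha> \<beta> f (Delete k') r"
      have eq: "top_down_update \<alpha> \<beta> f upd t = \<langle>l, k', r'\<rangle>"
        unfolding r'_def k'_def
        using False s(1) 4 by (subst top_down_update.simps) (auto simp: Let_def simp flip: hat)
      have u: "updated (Delete k') r r'" unfolding r'_def by (rule less.hyps[OF sz(2) bl(2) s(3)])
      have "r \<noteq> \<langle>\<rangle>"
      proof
        \<comment> \<open>Then \<open>l\<close> would weigh \<open>m - 1\<close>, more than
          \<open>\<alpha> * (m - 1)\<close>.\<close>
        assume "r = \<langle>\<rangle>"
        moreover have "\<alpha> * (m - 1) \<le> 3/4 * (m - 1)" using param_bounds m31 by (intro mult_right_mono) auto
        ultimately show False using h m m31 by (simp add: heavy_Node)
      qed
      note D = hd_inorder_least[OF bl(2) this, folded k'_def]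
      have "bst \<langle>l, k', r'\<rangle>" "set_tree \<langle>l, k', r'\<rangle> = update_set upd (set_tree t)"
        using u D bl b(2) 4 unfolding updated_def by force+
      then show ?thesis unfolding eq using right[OF u] by simp
    qed
  qed
qed

end

section \<open>The parameters\<close>

text \<open>Both claims compare a square root with a polynomial. After squaring, the differences
  contain the factor \<open>2 * \<alpha> * \<alpha> - 1\<close>, so both claims are equalities at
  \<alpha> = 1/sqrt 2.\<close>

lemma alpha_hat_bounds:
  assumes "1 \<le> 2 * (\<alpha> * \<alpha>)" "0 < \<alpha>" "\<alpha> < 3 / 4"
  shows "1 + \<alpha> \<le> alpha_hat \<alpha> * (1 + 2 * \<alpha>)" "alpha_hat \<alpha> \<le> \<alpha>"
proof -
  define S where "S = sqrt ((1 - \<alpha>) * (5 - \<alpha>))"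
  have a: "1 < 2 * \<alpha>"
  proof (rule ccontr)
    assume "\<not> ?thesis"
    then have "\<alpha> * \<alpha> \<le> 1/2 * (1/2)" using assms by (intro mult_mono) auto
    then show False using assms by simp
  qed
  have v: "alpha_hat \<alpha> * (5 * (2 * \<alpha> - 1)) = 1 - 2 * \<alpha> + 6 * (\<alpha> * \<alpha>) - S"
    using a by (simp add: alpha_hat_def S_def power2_eq_square)
  have "(1 - \<alpha>) * (1 + 4 * \<alpha>) \<le> S"
    unfolding S_def
  proof (rule real_le_rsqrt)
    have "0 \<le> 4 * (1 - \<alpha>) * (2 * \<alpha> - 1) * (2 * (\<alpha> * \<alpha>) - 1)"
      using assms a by (intro mult_nonneg_nonneg) auto
    also have "\<dots> = (1 - \<alpha>) * (5 - \<alpha>) - ((1 - \<alpha>) * (1 + 4 * \<alpha>))\<^sup>2" by algebra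
    finally show "((1 - \<alpha>) * (1 + 4 * \<alpha>))\<^sup>2 \<le> (1 - \<alpha>) * (5 - \<alpha>)" by simp
  qed
  then have "alpha_hat \<alpha> * (5 * (2 * \<alpha> - 1)) \<le> \<alpha> * (5 * (2 * \<alpha> - 1))"
    unfolding v by (simp add: algebra_simps)
  then show "alpha_hat \<alpha> \<le> \<alpha>" using a by simp
  \<comment> \<open>\<open>P\<close> is the value of \<open>(1 + 2 * \<alpha>) * S\<close> for which
    the first claim would be an equality.\<close>
  define P where "P = 6 - 5 * \<alpha> - 8 * (\<alpha> * \<alpha>) + 12 * (\<alpha> * \<alpha> * \<alpha>)"
  have le: "\<alpha> * \<alpha> \<le> 3/4 * (3/4)" using assms by (intro mult_mono) auto
  have "0 \<le> \<alpha> * (\<alpha> * \<alpha>)" using assms by simp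
  have "\<alpha> * 1 \<le> \<alpha> * (2 * (\<alpha> * \<alpha>))" using assms by (intro mult_left_mono) auto
  then have P: "0 \<le> P" using assms le unfolding P_def mult.assoc mult.left_commute[of \<alpha> 2] by linarith
  have "(1 + 2 * \<alpha>) * S = sqrt ((1 + 2 * \<alpha>)\<^sup>2 * ((1 - \<alpha>) * (5 - \<alpha>)))"
    using assms by (simp add: S_def real_sqrt_mult)
  also have "\<dots> \<le> P"
  proof (rule real_le_lsqrt[OF P])
    have "0 \<le> (2 * (\<alpha> * \<alpha>) - 1) * (2 * \<alpha> - 1) * (31 - 12 * \<alpha> - 30 * (\<alpha> * \<alpha>) + 36 * (\<alpha> * (\<alpha> * \<alpha>)))"
      using assms a le \<open>0 \<le> \<alpha> * (\<alpha> * \<alpha>)\<close> by (intro mult_nonneg_nonneg) auto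
    also have "\<dots> = P\<^sup>2 - (1 + 2 * \<alpha>)\<^sup>2 * ((1 - \<alpha>) * (5 - \<alpha>))" unfolding P_def by algebra
    finally show "(1 + 2 * \<alpha>)\<^sup>2 * ((1 - \<alpha>) * (5 - \<alpha>)) \<le> P\<^sup>2" by simp
  qed
  finally have "(1 + 2 * \<alpha>) * S \<le> P" .
  moreover have "(1 - 2 * \<alpha> + 6 * (\<alpha> * \<alpha>)) * (1 + 2 * \<alpha>) - P = (1 + \<alpha>) * (5 * (2 * \<alpha> - 1))"
    unfolding P_def by algebra
  ultimately have "(1 + \<alpha>) * (5 * (2 * \<alpha> - 1)) \<le> alpha_hat \<alpha> * (5 * (2 * \<alpha> - 1)) * (1 + 2 * \<alpha>)"
    unfolding v by (simp add: algebra_simps)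
  then have "(1 + \<alpha>) * (5 * (2 * \<alpha> - 1)) \<le> alpha_hat \<alpha> * (1 + 2 * \<alpha>) * (5 * (2 * \<alpha> - 1))"
    by (simp add: mult_ac)
  then show "1 + \<alpha> \<le> alpha_hat \<alpha> * (1 + 2 * \<alpha>)" using a by simp
qed

text \<open>\<open>beta_hat \<alpha> \<beta> / \<alpha>\<close> is the smaller root of \<open>q x\<^sup>2 - (1 + \<alpha>) x + \<alpha>\<close> where \<open>q = 1 - \<alpha>\<^sup>2 + \<beta>\<close>,
  so the sign of this polynomial at \<open>x\<close> decides on which side of \<open>\<alpha> x\<close> it lies.\<close>

lemma beta_hat_compare:
  assumes "0 < \<alpha>" "\<beta> \<le> \<alpha>\<^sup>2" and q: "0 < q" "q = 1 - \<alpha>\<^sup>2 + \<beta>"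
  shows "q * x\<^sup>2 - (1 + \<alpha>) * x + \<alpha> \<le> 0 \<Longrightarrow> beta_hat \<alpha> \<beta> \<le> \<alpha> * x"
    and "0 \<le> q * x\<^sup>2 - (1 + \<alpha>) * x + \<alpha> \<Longrightarrow> 2 * q * x \<le> 1 + \<alpha> \<Longrightarrow> \<alpha> * x \<le> beta_hat \<alpha> \<beta>"
proof -
  \<comment> \<open>The discriminant
    \<open>(1 + \<alpha>)\<^sup>2 - 4 * q * \<alpha>\<close>.\<close>
  define E where "E = (1 - \<alpha>)\<^sup>2 + 4 * \<alpha> * (\<alpha>\<^sup>2 - \<beta>)"
  have h: "beta_hat \<alpha> \<beta> = (1 + \<alpha> - sqrt E) / (2 * q) * \<alpha>"
    by (simp add: beta_hat_def E_def q)
  have sq: "(1 + \<alpha> - 2 * q * x)\<^sup>2 = 4 * q * (q * x\<^sup>2 - (1 + \<alpha>) * x + \<alpha>) + E"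
    unfolding E_def q(2) by algebra
  show "beta_hat \<alpha> \<beta> \<le> \<alpha> * x" if "q * x\<^sup>2 - (1 + \<alpha>) * x + \<alpha> \<le> 0"
  proof -
    have "4 * q * (q * x\<^sup>2 - (1 + \<alpha>) * x + \<alpha>) \<le> 0"
      using that q by (simp add: mult_nonneg_nonpos)
    then have "1 + \<alpha> - 2 * q * x \<le> sqrt E"
      using sq by (intro real_le_rsqrt) simp
    then have "(1 + \<alpha> - sqrt E) / (2 * q) \<le> x"
      using q by (simp add: pos_divide_le_eq mult_ac)
    then show ?thesis unfolding h mult.commute[of \<alpha> x]
      by (rule mult_right_mono) (use assms(1) in simp)
  qed
  show "\<alpha> * x \<le> beta_hat \<alpha> \<beta>" if "0 \<le> q * x\<^sup>2 - (1 + \<alpha>) * x + \<alpha>" "2 * q * x \<le> 1 + \<alpha>"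
  proof -
    \<comment> \<open>The second assumption puts \<open>x\<close> to the left of the vertex, hence
      to the left of the smaller root.\<close>
    have "sqrt E \<le> 1 + \<alpha> - 2 * q * x"
      using that q sq by (intro real_le_lsqrt) simp_all
    then have "x \<le> (1 + \<alpha> - sqrt E) / (2 * q)"
      using q by (simp add: pos_le_divide_eq mult_ac)
    then show ?thesis unfolding h mult.commute[of \<alpha> x]
      by (rule mult_right_mono) (use assms(1) in simp)
  qed
qed

text \<open>The polynomial is tested at \<open>\<beta> / \<alpha>\<close>,
  \<open>1 / (1 + B)\<close> and \<open>1 / (2 - \<beta>)\<close>, whose multiples by \<alpha> are
  \<beta>, \<open>B\<close> and \<open>\<alpha> / (2 - \<beta>)\<close>.\<close>

lemma beta_hat_bounds:
  assumes aB: "\<alpha> = B + B\<^sup>2" and B: "478 / 1000 < B" "B < 1 / 2" and b: "B \<le> \<beta>" "\<beta> \<le> \<alpha>\<^sup>2"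
    and a: "\<alpha> < 3 / 4" "7071 / 10000 < \<alpha>"
  shows "B \<le> beta_hat \<alpha> \<beta>" "beta_hat \<alpha> \<beta> \<le> \<beta>" "\<alpha> \<le> beta_hat \<alpha> \<beta> * (2 - \<beta>)"
proof -
  define q where "q = 1 - \<alpha>\<^sup>2 + \<beta>"
  have a2: "\<alpha>\<^sup>2 < 9/16" using power_strict_mono[of \<alpha> "3/4" 2] a by (simp add: power2_eq_square)
  have q: "0 < q" "q \<le> 1" using a2 b B by (auto simp: q_def)
  have "\<alpha> \<noteq> 0" "0 < \<alpha>" using a by auto
  note cmp = beta_hat_compare[OF \<open>0 < \<alpha>\<close> b(2) q(1) q_def]
  have B2: "B\<^sup>2 \<le> \<beta>\<^sup>2" using B b by (intro power_mono) auto
  have "q * (\<beta> / \<alpha>)\<^sup>2 - (1 + \<alpha>) * (\<beta> / \<alpha>) + \<alpha> = (\<alpha>\<^sup>2 - \<beta>) * (\<alpha> - \<beta> - \<beta>\<^sup>2) / \<alpha>\<^sup>2"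
    using \<open>\<alpha> \<noteq> 0\<close> unfolding q_def by (simp add: field_simps power2_eq_square)
  also have "\<dots> \<le> 0"
    using b aB B2 by (intro divide_nonpos_nonneg mult_nonneg_nonpos) auto
  finally show "beta_hat \<alpha> \<beta> \<le> \<beta>" using cmp(1)[of "\<beta> / \<alpha>"] \<open>\<alpha> \<noteq> 0\<close> by simp
  have scaled: "(q * (1 / w)\<^sup>2 - c * (1 / w) + \<alpha>) * w\<^sup>2 = q - c * w + \<alpha> * w\<^sup>2" if "w \<noteq> 0" for c w
    using that by (simp add: field_simps power2_eq_square)
  have "0 < 1 + B" using B by simp
  have "(q * (1 / (1 + B))\<^sup>2 - (1 + \<alpha>) * (1 / (1 + B)) + \<alpha>) * (1 + B)\<^sup>2
      = q - (1 + \<alpha>) * (1 + B) + \<alpha> * (1 + B)\<^sup>2"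
    using \<open>0 < 1 + B\<close> by (intro scaled) simp
  also have "\<dots> = \<beta> - B" unfolding q_def aB by algebra
  finally have "0 \<le> (q * (1 / (1 + B))\<^sup>2 - (1 + \<alpha>) * (1 / (1 + B)) + \<alpha>) * (1 + B)\<^sup>2" using b by simp
  then have f: "0 \<le> q * (1 / (1 + B))\<^sup>2 - (1 + \<alpha>) * (1 / (1 + B)) + \<alpha>"
    using \<open>0 < 1 + B\<close> by (simp add: zero_le_mult_iff)
  have "2 * q * (1 / (1 + B)) \<le> 2 * 1 * (1 / (1 + 478/1000))"
    using q B by (intro mult_mono divide_left_mono) auto
  then have "\<alpha> * (1 / (1 + B)) \<le> beta_hat \<alpha> \<beta>" using f a by (intro cmp(2)) auto
  moreover have "\<alpha> * (1 / (1 + B)) = B"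
    using \<open>0 < 1 + B\<close> by (simp add: aB field_simps power2_eq_square)
  ultimately show "B \<le> beta_hat \<alpha> \<beta>" by simp
  have b2: "0 < 2 - \<beta>" using b a2 by simp
  \<comment> \<open>This is the polynomial at \<open>1 / (2 - \<beta>)\<close>, cleared of
    denominators and grouped by the non-negative factors \<open>1 - 2 * B\<close> and
    \<open>\<beta> - B\<close>.\<close>
  have h: "0 \<le> (1 - 2 * B) * (2 * \<alpha> - 1) + (\<beta> - B) * (\<alpha> * (\<beta> + B) - 3 * \<alpha> + 2)"
  proof -
    have "\<alpha> * (3 - (\<beta> + B)) \<le> 3/4 * (3 - (478/1000 + 478/1000))"
      using a B b a2 by (intro mult_mono) auto
    then have "0 \<le> \<alpha> * (\<beta> + B) - 3 * \<alpha> + 2" by (simp add: algebra_simps)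
    then show ?thesis using B b a by (intro add_nonneg_nonneg[OF mult_nonneg_nonneg mult_nonneg_nonneg]) auto
  qed
  have "(q * (1 / (2 - \<beta>))\<^sup>2 - (1 + \<alpha>) * (1 / (2 - \<beta>)) + \<alpha>) * (2 - \<beta>)\<^sup>2
      = q - (1 + \<alpha>) * (2 - \<beta>) + \<alpha> * (2 - \<beta>)\<^sup>2"
    using b2 by (intro scaled) simp
  also have "\<dots> = (1 - 2 * B) * (2 * \<alpha> - 1) + (\<beta> - B) * (\<alpha> * (\<beta> + B) - 3 * \<alpha> + 2)"
    unfolding q_def aB by algebra
  finally have "0 \<le> (q * (1 / (2 - \<beta>))\<^sup>2 - (1 + \<alpha>) * (1 / (2 - \<beta>)) + \<alpha>) * (2 - \<beta>)\<^sup>2" using h by simp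
  then have f: "0 \<le> q * (1 / (2 - \<beta>))\<^sup>2 - (1 + \<alpha>) * (1 / (2 - \<beta>)) + \<alpha>"
    using b2 by (simp add: zero_le_mult_iff)
  have "2 * q * (1 / (2 - \<beta>)) \<le> 2 * 1 * (1 / (2 - 9/16))"
    using q b2 b a2 by (intro mult_mono divide_left_mono) auto
  then have "\<alpha> * (1 / (2 - \<beta>)) \<le> beta_hat \<alpha> \<beta>" using f a by (intro cmp(2)) auto
  then show "\<alpha> \<le> beta_hat \<alpha> \<beta> * (2 - \<beta>)" using b2 by (simp add: pos_divide_le_eq)
qed

theorem theorem4:
  fixes \<alpha> \<beta> :: real
    and T :: "'a::linorder tree"
    and upd :: "'a update"
    and restructure :: "'a tree \<Rightarrow> 'a tree"
  assumes "1 / sqrt 2 \<le> \<alpha>" and "\<alpha> < 3 / 4"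
    and "B_min \<alpha> \<le> \<beta>" and "\<beta> \<le> \<alpha>^2"
    and "perfect_restructuring restructure"
    and "GCB \<alpha> \<beta> T"
  shows "GCB \<alpha> \<beta> (top_down_update \<alpha> \<beta> restructure upd T)"
proof -
  define B where "B = B_min \<alpha>"
  have a0: "0 < \<alpha>"
    using assms(1) by (rule less_le_trans[rotated]) simp
  have "(1 / sqrt 2)\<^sup>2 \<le> \<alpha>\<^sup>2"
    using assms(1) by (intro power_mono) auto
  then have a2: "1 \<le> 2 * (\<alpha> * \<alpha>)"
    by (simp add: power_divide power2_eq_square)
  have a1: "7071 / 10000 < \<alpha>"
  proof (rule ccontr)
    assume "\<not> ?thesis"
    then have "\<alpha> * \<alpha> \<le> 7071 / 10000 * (7071 / 10000)" using a0 by (intro mult_mono) auto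
    then show False using a2 by simp
  qed
  have aB: "\<alpha> = B + B\<^sup>2"
    using a0 by (simp add: B_def B_min_def power2_eq_square field_simps)
  have "sqrt (1 + 4 * \<alpha>) < sqrt (2\<^sup>2)"
    using assms(2) by (intro real_sqrt_less_mono) simp
  then have B2: "B < 1 / 2" by (simp add: B_def B_min_def)
  \<comment> \<open>\<open>1.956 = 1 + 2 * 0.478\<close>, and its square 3.825936 is below
    \<open>1 + 4 * 0.7071\<close>.\<close>
  have "sqrt ((1956/1000)\<^sup>2) < sqrt (1 + 4 * \<alpha>)"
    using a1 by (intro real_sqrt_less_mono) (simp add: power2_eq_square)
  then have B1: "478 / 1000 < B" by (simp add: B_def B_min_def)
  note bh = beta_hat_bounds[OF aB B1 B2 assms(3)[folded B_def] assms(4) assms(2) a1]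
  interpret gcb_params \<alpha> \<beta> B "alpha_hat \<alpha>" "beta_hat \<alpha> \<beta>"
    by unfold_locales
      (use aB B1 B2 a2 assms(3,4) bh alpha_hat_bounds[OF a2 a0 assms(2)] in
        \<open>auto simp: B_def power2_eq_square\<close>)
  show ?thesis
    using top_down_update_updated[OF assms(5) refl refl, of T upd] assms(6)
    by (simp add: GCB_iff updated_def)
qed

end
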